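(* For every nontrivial dominant weight $\lambda\ne(0,0,0)$ of $\mathrm{SL}_4$, $$\sum_{q\ge0} b_q(\lambda)\ \geq\ |\chi_\lambda^0|+|\chi_\lambda^1|\ \geq\ |\chi_\lambda|.$$
   Context: For $\lambda=\ell_1\omega_1+\ell_2\omega_2+\ell_3\omega_3$ with $\ell_1,\ell_2,\ell_3\in\mathbb{Z}_{\ge0}$ (diagonal torus, upper-triangular Borel, $\omega_i=\epsilon_1+\dots+\epsilon_i$), $\mathcal{M}_\lambda$ is the irreducible finite-dimensional rational algebraic representation of $\mathrm{SL}_4$ over $\mathbb{Q}$ with highest weight $\lambda$, viewed as an $\mathrm{SL}_4(\mathbb{Z})$-module, and $\widetilde{\mathcal{M}}_\lambda$ is its polynomial extension to $\mathrm{GL}_4$, with highest weight $(\ell_1+\ell_2+\ell_3,\ell_2+\ell_3,\ell_3,0)$, viewed as a $\mathrm{GL}_4(\mathbb{Z})$-module. For $q\ge0$ and $\varepsilon\in\{0,1\}$, $$b_q(\lambda)=\dim_{\mathbb{Q}} H^q(\mathrm{SL}_4(\mathbb{Z}),\mathcal{M}_\lambda),\qquad \chi_\lambda=\sum_{q\ge0}(-1)^qb_q(\lambda),$$ $$\chi_\lambda^\varepsilon=\sum_{q\ge0}(-1)^q\dim_{\mathbb{Q}} H^q\bigl(\mathrm{GL}_4(\mathbb{Z}),\widetilde{\mathcal{M}}_\lambda\otimes\det{}^{\varepsilon}\bigr)$$ (finite sums of finite numbers). *)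

theory Defs
  imports "HOL-Analysis.Analysis" "HOL-Algebra.Group"
begin

section \<open>Group cohomology\<close>

text \<open>
  A \<open>G\<close>-module structure on \<open>'a^'n\<close> is given by a map \<open>act\<close> from \<open>carrier G\<close> to matrices.
  Cohomology is that of the complex of inhomogeneous cochains. A cochain of degree \<open>q\<close> is a
  function on \<open>G\<^sup>q\<close>, represented as a function on lists that is \<open>0\<close> off the lists of
  length \<open>q\<close> over \<open>carrier G\<close>.
\<close>

definition tuples :: "('g, 'm) monoid_scheme \<Rightarrow> nat \<Rightarrow> 'g list set" where
  "tuples G q = {gs \<in> lists (carrier G). length gs = q}"

definition cochains :: "('g, 'm) monoid_scheme \<Rightarrow> nat \<Rightarrow> ('g list \<Rightarrow> 'a::field^'n) set" where
  "cochains G q = {f. \<forall>gs. gs \<notin> tuples G q \<longrightarrow> f gs = 0}"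

definition merge_at :: "('g, 'm) monoid_scheme \<Rightarrow> nat \<Rightarrow> 'g list \<Rightarrow> 'g list" where
  "merge_at G i gs = take i gs @ (gs ! i \<otimes>\<^bsub>G\<^esub> gs ! Suc i) # drop (i + 2) gs"

text \<open>
  The usual formula
  \<open>(df)(g\<^sub>1,\<dots>,g\<^bsub>q+1\<^esub>) = g\<^sub>1 f(g\<^sub>2,\<dots>) + \<Sum>\<^sub>i (-1)\<^sup>i f(\<dots>,g\<^sub>i g\<^bsub>i+1\<^esub>,\<dots>) + (-1)\<^bsup>q+1\<^esup> f(g\<^sub>1,\<dots>,g\<^sub>q)\<close>,
  with the middle index shifted because list positions start at \<open>0\<close>.
\<close>

definition coboundary ::
  "('g, 'm) monoid_scheme \<Rightarrow> ('g \<Rightarrow> 'a::field^'n^'n) \<Rightarrow> nat \<Rightarrow> ('g list \<Rightarrow> 'a^'n) \<Rightarrow> 'g list \<Rightarrow> 'a^'n" where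
  "coboundary G act q f = (\<lambda>gs.
     if gs \<in> tuples G (Suc q)
     then act (hd gs) *v f (tl gs)
          + (\<Sum>i<q. (- 1) ^ Suc i *s f (merge_at G i gs))
          + (- 1) ^ Suc q *s f (butlast gs)
     else 0)"

definition cocycles ::
  "('g, 'm) monoid_scheme \<Rightarrow> ('g \<Rightarrow> 'a::field^'n^'n) \<Rightarrow> nat \<Rightarrow> ('g list \<Rightarrow> 'a^'n) set" where
  "cocycles G act q = {f \<in> cochains G q. coboundary G act q f = (\<lambda>_. 0)}"

definition coboundaries ::
  "('g, 'm) monoid_scheme \<Rightarrow> ('g \<Rightarrow> 'a::field^'n^'n) \<Rightarrow> nat \<Rightarrow> ('g list \<Rightarrow> 'a^'n) set" where
  "coboundaries G act q =
     (case q of 0 \<Rightarrow> {\<lambda>_. 0} | Suc p \<Rightarrow> coboundary G act p ` cochains G p)"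

text \<open>
  For subspaces \<open>B \<subseteq> Z\<close> of a space of functions, \<open>quotient_dim Z B\<close> is the dimension of \<open>Z / B\<close>,
  with value \<open>\<infinity>\<close> if it is infinite: \<open>independent_mod B S\<close> says that the cosets modulo \<open>B\<close> of the
  elements of \<open>S\<close> are (distinct and) linearly independent.
\<close>

definition independent_mod :: "('x \<Rightarrow> 'a::field^'n) set \<Rightarrow> ('x \<Rightarrow> 'a^'n) set \<Rightarrow> bool" where
  "independent_mod B S \<longleftrightarrow>
     (\<forall>c. (\<lambda>x. \<Sum>s\<in>S. c s *s s x) \<in> B \<longrightarrow> (\<forall>s\<in>S. c s = 0))"

definition quotient_dim :: "('x \<Rightarrow> 'a::field^'n) set \<Rightarrow> ('x \<Rightarrow> 'a^'n) set \<Rightarrow> enat" where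
  "quotient_dim Z B =
     (SUP S \<in> {S. finite S \<and> S \<subseteq> Z \<and> independent_mod B S}. enat (card S))"

definition cohomology_dim ::
  "('g, 'm) monoid_scheme \<Rightarrow> ('g \<Rightarrow> 'a::field^'n^'n) \<Rightarrow> nat \<Rightarrow> enat" where
  "cohomology_dim G act q = quotient_dim (cocycles G act q) (coboundaries G act q)"

text \<open>
  The alternating sum of a sequence of dimensions. It is meaningful when finitely many
  of the dimensions are nonzero and all are finite, i.e. when their sum is finite; otherwise it
  is set to \<open>0\<close>.
\<close>

definition euler_char :: "(nat \<Rightarrow> enat) \<Rightarrow> int" where
  "euler_char b =
     (if (\<Sum>q. b q) = \<infinity> then 0 else (\<Sum>q | b q \<noteq> 0. (- 1) ^ q * int (the_enat (b q))))"


section \<open>Algebraic representations and highest weights\<close>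

inductive polynomial_fun :: "('a::comm_ring_1^'m^'m \<Rightarrow> 'a) \<Rightarrow> bool" where
  const: "polynomial_fun (\<lambda>_. c)"
| entry: "polynomial_fun (\<lambda>A. A $ i $ j)"
| add: "polynomial_fun p \<Longrightarrow> polynomial_fun q \<Longrightarrow> polynomial_fun (\<lambda>A. p A + q A)"
| mult: "polynomial_fun p \<Longrightarrow> polynomial_fun q \<Longrightarrow> polynomial_fun (\<lambda>A. p A * q A)"

definition SL4_Q :: "(rat^4^4) set" where
  "SL4_Q = {A. det A = 1}"

definition GL4_Q :: "(rat^4^4) set" where
  "GL4_Q = {A. invertible A}"

text \<open>
  A representation of \<open>K\<close> on \<open>\<rat>\<^sup>n\<close> whose matrix coefficients are polynomials in the matrix
  entries. For \<open>K = SL4_Q\<close> these are exactly the rational representations of the algebraic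
  group \<open>SL\<^sub>4\<close> over \<open>\<rat>\<close>, because its coordinate ring is a quotient of the polynomial ring
  in the entries and the rational points are Zariski dense.
\<close>

definition polynomial_rep :: "(rat^4^4) set \<Rightarrow> (rat^4^4 \<Rightarrow> rat^'n^'n) \<Rightarrow> bool" where
  "polynomial_rep K \<rho> \<longleftrightarrow>
     \<rho> (mat 1) = mat 1 \<and>
     (\<forall>A\<in>K. \<forall>B\<in>K. \<rho> (A ** B) = \<rho> A ** \<rho> B) \<and>
     (\<forall>i j. \<exists>p. polynomial_fun p \<and> (\<forall>A\<in>K. \<rho> A $ i $ j = p A))"

definition irreducible_rep :: "(rat^4^4) set \<Rightarrow> (rat^4^4 \<Rightarrow> rat^'n^'n) \<Rightarrow> bool" where
  "irreducible_rep K \<rho> \<longleftrightarrow>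
     (\<forall>W. vec.subspace W \<and> (\<forall>A\<in>K. \<forall>w\<in>W. \<rho> A *v w \<in> W) \<longrightarrow> W = {0} \<or> W = UNIV)"

text \<open>
  The type \<open>4\<close> consists of \<open>0 < 1 < 2 < 3\<close>, so the index \<open>k\<close> corresponds to the
  character \<open>\<epsilon>\<^bsub>k+1\<^esub>\<close> of the diagonal torus.
\<close>

definition upper_triangular :: "rat^4^4 \<Rightarrow> bool" where
  "upper_triangular A \<longleftrightarrow> (\<forall>i j. j < i \<longrightarrow> A $ i $ j = 0)"

text \<open>
  A maximal vector of weight \<open>\<mu>\<close>: the upper triangular Borel subgroup acts on it through the
  character \<open>A \<mapsto> \<Prod>\<^sub>k A\<^bsub>kk\<^esub>\<^bsup>\<mu> k\<^esup>\<close>; that is, the unipotent upper triangular matrices fix it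
  and the diagonal torus acts by \<open>\<mu>\<close>.
\<close>

definition has_highest_weight ::
  "(rat^4^4) set \<Rightarrow> (4 \<Rightarrow> nat) \<Rightarrow> (rat^4^4 \<Rightarrow> rat^'n^'n) \<Rightarrow> bool" where
  "has_highest_weight K \<mu> \<rho> \<longleftrightarrow>
     (\<exists>v. v \<noteq> 0 \<and>
       (\<forall>A\<in>K. upper_triangular A \<longrightarrow> \<rho> A *v v = (\<Prod>k\<in>UNIV. (A $ k $ k) ^ \<mu> k) *s v))"

definition irreducible_hw_rep ::
  "(rat^4^4) set \<Rightarrow> (4 \<Rightarrow> nat) \<Rightarrow> (rat^4^4 \<Rightarrow> rat^'n^'n) \<Rightarrow> bool" where
  "irreducible_hw_rep K \<mu> \<rho> \<longleftrightarrow>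
     polynomial_rep K \<rho> \<and> irreducible_rep K \<rho> \<and> has_highest_weight K \<mu> \<rho>"

text \<open>
  The weight \<open>l\<^sub>1 \<omega>\<^sub>1 + l\<^sub>2 \<omega>\<^sub>2 + l\<^sub>3 \<omega>\<^sub>3\<close> with \<open>\<omega>\<^sub>i = \<epsilon>\<^sub>1 + \<dots> + \<epsilon>\<^sub>i\<close>, that is
  \<open>(l\<^sub>1 + l\<^sub>2 + l\<^sub>3, l\<^sub>2 + l\<^sub>3, l\<^sub>3, 0)\<close> in the coordinates \<open>\<epsilon>\<^sub>1, \<dots>, \<epsilon>\<^sub>4\<close>.
\<close>

definition dominant_weight :: "nat \<Rightarrow> nat \<Rightarrow> nat \<Rightarrow> 4 \<Rightarrow> nat" where
  "dominant_weight l1 l2 l3 k =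
     (if k = 0 then l1 + l2 + l3 else if k = 1 then l2 + l3 else if k = 2 then l3 else 0)"

definition det_twist :: "nat \<Rightarrow> (rat^4^4 \<Rightarrow> rat^'n^'n) \<Rightarrow> rat^4^4 \<Rightarrow> rat^'n^'n" where
  "det_twist e \<rho> A = mat (det A ^ e) ** \<rho> A"


section \<open>The arithmetic groups and their Betti numbers\<close>

definition GL4_Z :: "(int^4^4) monoid" where
  "GL4_Z = \<lparr>carrier = {A. invertible A}, mult = (**), one = mat 1\<rparr>"

definition SL4_Z :: "(int^4^4) monoid" where
  "SL4_Z = \<lparr>carrier = {A. det A = 1}, mult = (**), one = mat 1\<rparr>"

definition restrict_Z :: "(rat^4^4 \<Rightarrow> rat^'n^'n) \<Rightarrow> int^4^4 \<Rightarrow> rat^'n^'n" where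
  "restrict_Z \<rho> g = \<rho> (map_matrix of_int g)"

definition betti_SL :: "(rat^4^4 \<Rightarrow> rat^'n^'n) \<Rightarrow> nat \<Rightarrow> enat" where
  "betti_SL \<rho> q = cohomology_dim SL4_Z (restrict_Z \<rho>) q"

definition chi_SL :: "(rat^4^4 \<Rightarrow> rat^'n^'n) \<Rightarrow> int" where
  "chi_SL \<rho> = euler_char (betti_SL \<rho>)"

definition chi_GL :: "nat \<Rightarrow> (rat^4^4 \<Rightarrow> rat^'n^'n) \<Rightarrow> int" where
  "chi_GL e \<rho> = euler_char (cohomology_dim GL4_Z (restrict_Z (det_twist e \<rho>)))"

end

theory Submission
  imports Defs "HOL-Library.Function_Algebras"
begin

text \<open>
  The group \<open>SL\<^sub>4(\<int>)\<close> is the kernel of the determinant on \<open>GL\<^sub>4(\<int>)\<close>, a subgroup of index two, and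
  the given module of \<open>SL\<^sub>4(\<int>)\<close> is the restriction of one of \<open>GL\<^sub>4(\<int>)\<close>. Inducing it back gives the
  sum of the \<open>GL\<^sub>4(\<int>)\<close>-module and its twist by the determinant, so Shapiro's lemma yields
  \<open>b\<^sub>q = dim H\<^sup>q(GL\<^sub>4(\<int>), M) + dim H\<^sup>q(GL\<^sub>4(\<int>), M \<otimes> det)\<close>
  in every degree (\<open>betti_SL_decomposition\<close>). Both inequalities are then triangle inequalities: an
  Euler characteristic is bounded by the sum of the dimensions, and if
  that sum is finite, the characteristic of \<open>SL\<^sub>4(\<int>)\<close> is the sum of the other two; if it is infinite,
  the characteristic of \<open>SL\<^sub>4(\<int>)\<close> is \<open>0\<close> by definition (\<open>euler_char_add\<close>).

  The decomposition is proved by cochains, for any group with a surjective character onto \<open>{1, -1}\<close>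
  and coefficients in a field in which \<open>2\<close> is invertible (\<open>cohomology_dim_index_two\<close>). Let \<open>H\<close> be
  the kernel of the character on \<open>G\<close>. Inhomogeneous cochains are replaced by homogeneous ones, that
  is, by equivariant functions on tuples of vertices (\<open>cohomology_dim_homogeneous\<close>). An
  \<open>H\<close>-equivariant function on tuples of \<open>H\<close> may then be replaced by one on tuples of \<open>G\<close>: there is
  an \<open>H\<close>-equivariant retraction of \<open>G\<close> onto \<open>H\<close>, and the prism operator shows that it does not
  change cohomology (\<open>hom_cohomology_dim_retract\<close>). On the complex of \<open>H\<close>-equivariant functions on
  tuples of \<open>G\<close> the quotient \<open>G/H\<close> of order two acts; its two eigenspaces are the complexes of \<open>G\<close>
  with coefficients in the module and in its twist (\<open>hom_cohomology_dim_split\<close>). Dimensions of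
  quotients are compared by \<open>quotient_dim_direct_sum\<close>.
\<close>

section \<open>Dimensions of quotients of function spaces\<close>

text \<open>
  Function spaces become vector spaces under pointwise operations, which makes the theory of
  span and independence available for cochains.
\<close>

definition fscale :: "'a::field \<Rightarrow> ('x \<Rightarrow> 'a^'n) \<Rightarrow> 'x \<Rightarrow> 'a^'n" where
  "fscale c f = (\<lambda>x. c *s f x)"

lemma fscale_apply [simp]: "fscale c f x = c *s f x"
  by (simp add: fscale_def)

global_interpretation fun_vs: vector_space "fscale :: 'a::field \<Rightarrow> ('x \<Rightarrow> 'a^'n) \<Rightarrow> 'x \<Rightarrow> 'a^'n"
  by unfold_locales
    (simp_all add: fun_eq_iff vector_add_ldistrib vector_sadd_rdistrib vector_smult_assoc)

lemma sum_fun_apply: "(\<Sum>i\<in>I. f i) x = (\<Sum>i\<in>I. f i x)"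
  for f :: "'i \<Rightarrow> 'x \<Rightarrow> 'b::comm_monoid_add"
  by (induction I rule: infinite_finite_induct) auto

lemma independent_mod_iff:
  "independent_mod B S \<longleftrightarrow> (\<forall>c. (\<Sum>s\<in>S. fscale (c s) s) \<in> B \<longrightarrow> (\<forall>s\<in>S. c s = 0))"
proof -
  have "(\<lambda>x. \<Sum>s\<in>S. c s *s s x) = (\<Sum>s\<in>S. fscale (c s) s)" for c
    by (rule ext) (simp add: sum_fun_apply)
  then show ?thesis
    by (simp add: independent_mod_def)
qed

text \<open>
  Steinitz exchange modulo \<open>B\<close>. Only finitely many elements of \<open>B\<close> are needed to correct the
  elements of \<open>S\<close> into the span of \<open>T\<close>; with an independent set \<open>F\<close> spanning these, \<open>S \<union> F\<close> is
  independent in the usual sense and lies in the span of \<open>T \<union> F\<close>, and \<open>card F\<close> cancels.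
\<close>

lemma independent_mod_card_le:
  assumes B: "fun_vs.subspace B"
    and S: "finite S" "independent_mod B S" and T: "finite T"
    and span: "\<And>s. s \<in> S \<Longrightarrow> \<exists>r\<in>B. s - r \<in> fun_vs.span T"
  shows "card S \<le> card T"
proof -
  obtain r where r: "\<And>s. s \<in> S \<Longrightarrow> r s \<in> B \<and> s - r s \<in> fun_vs.span T"
    using span by metis
  obtain F where F: "F \<subseteq> r ` S" "fun_vs.independent F" "r ` S \<subseteq> fun_vs.span F"
    using fun_vs.maximal_independent_subset[of "r ` S"] by blast
  have finF: "finite F" using F(1) S(1) by (meson finite_imageI finite_subset)
  have FB: "F \<subseteq> B" using F(1) r by blast
  have ind: "(\<Sum>s\<in>S. fscale (c s) s) \<in> B \<Longrightarrow> s \<in> S \<Longrightarrow> c s = 0" for c s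
    using S(2) by (auto simp: independent_mod_iff)
  have disj: "S \<inter> F = {}"
  proof (rule ccontr)
    assume "S \<inter> F \<noteq> {}"
    then obtain x where x: "x \<in> S" "x \<in> B" using FB by blast
    have "(\<Sum>s\<in>S. fscale (if s = x then 1 else 0) s) = (\<Sum>s\<in>S. if s = x then x else 0)"
      by (rule sum.cong) auto
    also have "\<dots> = x" using x S(1) by simp
    finally show False using ind[of "\<lambda>s. if s = x then 1 else 0" x] x by simp
  qed
  have "fun_vs.independent (S \<union> F)"
  proof
    assume "fun_vs.dependent (S \<union> F)"
    then obtain u where u: "\<exists>v\<in>S \<union> F. u v \<noteq> 0" "(\<Sum>v\<in>S \<union> F. fscale (u v) v) = 0"
      using fun_vs.dependent_finite[of "S \<union> F"] S(1) finF by auto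
    have eq: "(\<Sum>v\<in>S. fscale (u v) v) + (\<Sum>v\<in>F. fscale (u v) v) = 0"
      using u(2) sum.union_disjoint[OF S(1) finF disj] by metis
    have "(\<Sum>v\<in>F. fscale (u v) v) \<in> B"
      using FB by (auto intro!: fun_vs.subspace_sum fun_vs.subspace_scale B)
    moreover have "(\<Sum>v\<in>S. fscale (u v) v) = - (\<Sum>v\<in>F. fscale (u v) v)"
      using eq by (rule iffD2[OF eq_neg_iff_add_eq_0])
    ultimately have "(\<Sum>v\<in>S. fscale (u v) v) \<in> B"
      using fun_vs.subspace_neg[OF B] by simp
    then have uS: "u v = 0" if "v \<in> S" for v
      using ind that by blast
    then have "(\<Sum>v\<in>F. fscale (u v) v) = 0"
      using eq by simp
    then have "u v = 0" if "v \<in> F" for v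
      using fun_vs.independentD[OF F(2) finF] that by blast
    then show False using u(1) uS by blast
  qed
  moreover have "S \<union> F \<subseteq> fun_vs.span (T \<union> F)"
  proof
    fix x assume "x \<in> S \<union> F"
    then show "x \<in> fun_vs.span (T \<union> F)"
    proof
      assume x: "x \<in> S"
      have "x - r x \<in> fun_vs.span (T \<union> F)" "r x \<in> fun_vs.span (T \<union> F)"
        using r[OF x] F(3) x fun_vs.span_mono[of T "T \<union> F"] fun_vs.span_mono[of F "T \<union> F"]
        by blast+
      then show ?thesis using fun_vs.span_add by fastforce
    qed (auto intro: fun_vs.span_base)
  qed
  ultimately have "card (S \<union> F) \<le> card (T \<union> F)"
    using fun_vs.independent_span_bound[of "T \<union> F"] T finF by blast
  also have "\<dots> \<le> card T + card F" by (rule card_Un_le)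
  finally show ?thesis using card_Un_disjoint[OF S(1) finF disj] by simp
qed

text \<open>
  Families replace sets in the next two lemmas, because independent sets from two different
  spaces will be put together along a disjoint sum of index sets.
\<close>

lemma quotient_dim_ge_family:
  assumes B: "fun_vs.subspace B" and I: "finite I" "v ` I \<subseteq> Z"
    and ind: "\<And>c i. (\<Sum>i\<in>I. fscale (c i) (v i)) \<in> B \<Longrightarrow> i \<in> I \<Longrightarrow> c i = 0"
  shows "enat (card I) \<le> quotient_dim Z B"
proof -
  have inj: "inj_on v I"
  proof (rule inj_onI, rule ccontr)
    fix i j assume ij: "i \<in> I" "j \<in> I" "v i = v j" "i \<noteq> j"
    \<comment> \<open>Two equal members give the relation \<open>v i - v j = 0\<close>.\<close>
    define c where "c k = (if k = i then 1 else if k = j then - 1 else 0 :: 'a)" for k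
    have "(\<Sum>k\<in>I. fscale (c k) (v k))
        = (\<Sum>k\<in>I. (if k = i then v i else 0) + (if k = j then - v j else 0))"
      using ij(4) by (intro sum.cong) (auto simp: c_def fun_vs.scale_minus_left)
    also have "\<dots> = 0" using ij I(1) by (simp add: sum.distrib)
    finally have "c i = 0"
      using ind[of c i] fun_vs.subspace_0[OF B] ij(1) by simp
    then show False by (simp add: c_def)
  qed
  have "independent_mod B (v ` I)"
    unfolding independent_mod_iff
  proof (intro allI impI ballI)
    fix c s assume h: "(\<Sum>s\<in>v ` I. fscale (c s) s) \<in> B" and "s \<in> v ` I"
    then obtain i where "i \<in> I" "s = v i" by blast
    then show "c s = 0"
      using ind[of "\<lambda>i. c (v i)"] h by (simp add: sum.reindex[OF inj])
  qed
  then show ?thesis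
    unfolding quotient_dim_def using I card_image[OF inj]
    by (intro SUP_upper2[of "v ` I"]) auto
qed

lemma quotient_dim_le_family:
  assumes B: "fun_vs.subspace B" and J: "finite J"
    and span: "\<And>z. z \<in> Z \<Longrightarrow> \<exists>c. z - (\<Sum>j\<in>J. fscale (c j) (w j)) \<in> B"
  shows "quotient_dim Z B \<le> enat (card J)"
  unfolding quotient_dim_def
proof (rule SUP_least)
  fix S assume S: "S \<in> {S. finite S \<and> S \<subseteq> Z \<and> independent_mod B S}"
  have "card S \<le> card (w ` J)"
  proof (rule independent_mod_card_le[OF B])
    fix s assume "s \<in> S"
    then obtain c where c: "s - (\<Sum>j\<in>J. fscale (c j) (w j)) \<in> B"
      using span S by blast
    have "(\<Sum>j\<in>J. fscale (c j) (w j)) \<in> fun_vs.span (w ` J)"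
      by (intro fun_vs.span_sum fun_vs.span_scale fun_vs.span_base) auto
    then show "\<exists>r\<in>B. s - r \<in> fun_vs.span (w ` J)"
      using c by (intro bexI[OF _ c]) simp
  qed (use S J in auto)
  also have "\<dots> \<le> card J" by (rule card_image_le[OF J])
  finally show "enat (card S) \<le> enat (card J)" by simp
qed

text \<open>
  A finite supremum of a set of extended naturals is attained, and an independent set of
  maximal size spans.
\<close>

lemma quotient_dim_basis:
  assumes B: "fun_vs.subspace B" and n: "quotient_dim Z B = enat n"
  obtains S where "finite S" "S \<subseteq> Z" "independent_mod B S" "card S = n"
    "\<forall>z\<in>Z. \<exists>c. z - (\<Sum>s\<in>S. fscale (c s) s) \<in> B"
proof -
  let ?A = "{S. finite S \<and> S \<subseteq> Z \<and> independent_mod B S}"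
  let ?E = "(\<lambda>S. enat (card S)) ` ?A"
  have ne: "?E \<noteq> {}" by (auto simp: independent_mod_def)
  have "Sup ?E = enat n" using n by (simp add: quotient_dim_def)
  then have "finite ?E" "Max ?E = enat n"
    using ne unfolding Sup_enat_def by (metis enat.distinct(1))+
  then have "enat n \<in> ?E" using Max_in[OF _ ne] by simp
  then obtain S where S: "finite S" "S \<subseteq> Z" "independent_mod B S" "card S = n"
    by auto
  have "\<exists>c. z - (\<Sum>s\<in>S. fscale (c s) s) \<in> B" if z: "z \<in> Z" for z
  proof (rule ccontr)
    assume neg: "\<nexists>c. z - (\<Sum>s\<in>S. fscale (c s) s) \<in> B"
    \<comment> \<open>A relation modulo \<open>B\<close> between \<open>z\<close> and \<open>S\<close> can be solved for \<open>z\<close>, so \<open>z\<close> could be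
      added to the maximal independent set \<open>S\<close>.\<close>
    have "enat (card (insert None (Some ` S))) \<le> quotient_dim Z B"
    proof (rule quotient_dim_ge_family[OF B, where v = "\<lambda>i. case i of None \<Rightarrow> z | Some s \<Rightarrow> s"])
      fix c i
      assume h: "(\<Sum>i\<in>insert None (Some ` S). fscale (c i) (case i of None \<Rightarrow> z | Some s \<Rightarrow> s)) \<in> B"
        and i: "i \<in> insert None (Some ` S)"
      have *: "fscale (c None) z + (\<Sum>s\<in>S. fscale (c (Some s)) s) \<in> B"
        using h S(1) by (simp add: sum.reindex)
      have c0: "c None = 0"
      proof (rule ccontr)
        assume nz: "c None \<noteq> 0"
        have "z - (\<Sum>s\<in>S. fscale (- (c (Some s) / c None)) s)
            = fscale (1 / c None) (fscale (c None) z + (\<Sum>s\<in>S. fscale (c (Some s)) s))"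
          using nz by (simp add: fun_vs.scale_right_distrib fun_vs.scale_sum_right
              fun_vs.scale_minus_left sum_negf)
        also have "\<dots> \<in> B" by (rule fun_vs.subspace_scale[OF B *])
        finally have "\<exists>c. z - (\<Sum>s\<in>S. fscale (c s) s) \<in> B"
          by (rule exI[of _ "\<lambda>s. - (c (Some s) / c None)"])
        then show False using neg by contradiction
      qed
      then have "(\<Sum>s\<in>S. fscale (c (Some s)) s) \<in> B" using * by simp
      then have "\<forall>s\<in>S. c (Some s) = 0"
        using spec[OF S(3)[unfolded independent_mod_iff], of "\<lambda>s. c (Some s)"] by simp
      then show "c i = 0" using i c0 by auto
    qed (use S z in auto)
    moreover have "card (insert None (Some ` S)) = Suc n"
      using S by (simp add: card_image)
    ultimately show False using n by simp
  qed
  then show thesis using that S by blast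
qed

lemma quotient_dim_geD:
  assumes "enat n \<le> quotient_dim Z B"
  obtains S where "finite S" "S \<subseteq> Z" "independent_mod B S" "n \<le> card S"
proof (cases n)
  case 0
  then show ?thesis using that[of "{}"] by (simp add: independent_mod_def)
next
  case (Suc m)
  then have "enat m < quotient_dim Z B"
    using assms by (metis Suc_ile_eq)
  then show ?thesis
    using that by (auto simp: quotient_dim_def less_SUP_iff Suc)
qed

lemma enat_le_addE:
  assumes "enat n \<le> a + b"
  obtains i j where "n = i + j" "enat i \<le> a" "enat j \<le> b"
proof (cases a)
  case (enat i)
  show ?thesis
  proof (cases "n \<le> i")
    case True
    then show ?thesis using that[of n 0] enat by (simp add: zero_enat_def[symmetric])
  next
    case False
    then show ?thesis using that[of i "n - i"] enat assms by (cases b) auto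
  qed
next
  case infinity
  then show ?thesis using that[of n 0] by (simp add: zero_enat_def[symmetric])
qed

text \<open>
  The hypotheses say that \<open>(z\<^sub>1, z\<^sub>2) \<mapsto> \<phi> z\<^sub>1 + \<psi> z\<^sub>2\<close> induces an isomorphism from
  \<open>Z\<^sub>1/B\<^sub>1 \<oplus> Z\<^sub>2/B\<^sub>2\<close> onto \<open>Z/B\<close>. The inequality \<open>\<le>\<close>
  combines two maximal independent sets into a spanning family, and \<open>\<ge>\<close> combines arbitrary
  independent sets into an independent family, which also settles infinite dimensions.
\<close>

lemma quotient_dim_direct_sum:
  assumes sub: "fun_vs.subspace Z1" "fun_vs.subspace Z2" "fun_vs.subspace B"
      "fun_vs.subspace B1" "fun_vs.subspace B2"
    and lin: "Vector_Spaces.linear fscale fscale \<phi>" "Vector_Spaces.linear fscale fscale \<psi>"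
    and Z: "\<phi> ` Z1 \<subseteq> Z" "\<psi> ` Z2 \<subseteq> Z" and B12: "\<phi> ` B1 \<subseteq> B" "\<psi> ` B2 \<subseteq> B"
    and inj: "\<And>z1 z2. z1 \<in> Z1 \<Longrightarrow> z2 \<in> Z2 \<Longrightarrow> \<phi> z1 + \<psi> z2 \<in> B \<Longrightarrow> z1 \<in> B1 \<and> z2 \<in> B2"
    and surj: "\<And>z. z \<in> Z \<Longrightarrow> \<exists>z1\<in>Z1. \<exists>z2\<in>Z2. z - (\<phi> z1 + \<psi> z2) \<in> B"
  shows "quotient_dim Z B = quotient_dim Z1 B1 + quotient_dim Z2 B2"
proof (rule antisym)
  note [simp] = module_hom.sum[OF module_hom_linearI] module_hom.scale[OF module_hom_linearI]
    module_hom.diff[OF module_hom_linearI]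
  show "quotient_dim Z B \<le> quotient_dim Z1 B1 + quotient_dim Z2 B2"
  proof (cases "quotient_dim Z1 B1 = \<infinity> \<or> quotient_dim Z2 B2 = \<infinity>")
    case False
    then obtain n1 n2 where n: "quotient_dim Z1 B1 = enat n1" "quotient_dim Z2 B2 = enat n2"
      by auto
    obtain S1 where S1: "finite S1" "S1 \<subseteq> Z1" "independent_mod B1 S1" "card S1 = n1"
      "\<forall>z\<in>Z1. \<exists>c. z - (\<Sum>s\<in>S1. fscale (c s) s) \<in> B1"
      by (rule quotient_dim_basis[OF sub(4) n(1)])
    obtain S2 where S2: "finite S2" "S2 \<subseteq> Z2" "independent_mod B2 S2" "card S2 = n2"
      "\<forall>z\<in>Z2. \<exists>c. z - (\<Sum>s\<in>S2. fscale (c s) s) \<in> B2"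
      by (rule quotient_dim_basis[OF sub(5) n(2)])
    have "quotient_dim Z B \<le> enat (card (S1 <+> S2))"
    proof (rule quotient_dim_le_family[OF sub(3), where w = "case_sum \<phi> \<psi>"])
      fix z assume "z \<in> Z"
      then obtain z1 z2 where z: "z1 \<in> Z1" "z2 \<in> Z2" "z - (\<phi> z1 + \<psi> z2) \<in> B"
        using surj by blast
      obtain c1 where c1: "z1 - (\<Sum>s\<in>S1. fscale (c1 s) s) \<in> B1" using S1(5) z(1) by blast
      obtain c2 where c2: "z2 - (\<Sum>s\<in>S2. fscale (c2 s) s) \<in> B2" using S2(5) z(2) by blast
      have "\<phi> (z1 - (\<Sum>s\<in>S1. fscale (c1 s) s)) \<in> B" "\<psi> (z2 - (\<Sum>s\<in>S2. fscale (c2 s) s)) \<in> B"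
        using c1 c2 B12 by blast+
      then have "(z - (\<phi> z1 + \<psi> z2)) + \<phi> (z1 - (\<Sum>s\<in>S1. fscale (c1 s) s))
          + \<psi> (z2 - (\<Sum>s\<in>S2. fscale (c2 s) s)) \<in> B"
        using z(3) sub(3) by (intro fun_vs.subspace_add) auto
      also have "(z - (\<phi> z1 + \<psi> z2)) + \<phi> (z1 - (\<Sum>s\<in>S1. fscale (c1 s) s))
          + \<psi> (z2 - (\<Sum>s\<in>S2. fscale (c2 s) s))
        = z - (\<Sum>j\<in>S1 <+> S2. fscale (case_sum c1 c2 j) (case_sum \<phi> \<psi> j))"
        using S1(1) S2(1) lin by (simp add: sum.Plus algebra_simps)
      finally show "\<exists>c. z - (\<Sum>j\<in>S1 <+> S2. fscale (c j) (case_sum \<phi> \<psi> j)) \<in> B" by blast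
    qed (use S1 S2 in auto)
    then show ?thesis using n S1 S2 by (simp add: card_Plus)
  qed auto
  have le: "enat n \<le> quotient_dim Z B" if n: "enat n \<le> quotient_dim Z1 B1 + quotient_dim Z2 B2" for n
  proof -
    from n obtain i j where ij: "n = i + j" "enat i \<le> quotient_dim Z1 B1" "enat j \<le> quotient_dim Z2 B2"
      by (rule enat_le_addE)
    obtain S1 where S1: "finite S1" "S1 \<subseteq> Z1" "independent_mod B1 S1" "i \<le> card S1"
      using quotient_dim_geD[OF ij(2)] .
    obtain S2 where S2: "finite S2" "S2 \<subseteq> Z2" "independent_mod B2 S2" "j \<le> card S2"
      using quotient_dim_geD[OF ij(3)] .
    have "enat (card (S1 <+> S2)) \<le> quotient_dim Z B"
    proof (rule quotient_dim_ge_family[OF sub(3), where v = "case_sum \<phi> \<psi>"])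
      fix c k assume h: "(\<Sum>i\<in>S1 <+> S2. fscale (c i) (case_sum \<phi> \<psi> i)) \<in> B"
        and k: "k \<in> S1 <+> S2"
      let ?z1 = "\<Sum>s\<in>S1. fscale (c (Inl s)) s" and ?z2 = "\<Sum>s\<in>S2. fscale (c (Inr s)) s"
      have "?z1 \<in> Z1" "?z2 \<in> Z2"
        using S1(2) S2(2) by (auto intro!: fun_vs.subspace_sum fun_vs.subspace_scale sub)
      moreover have "\<phi> ?z1 + \<psi> ?z2 \<in> B"
        using h S1(1) S2(1) lin by (simp add: sum.Plus)
      ultimately have "?z1 \<in> B1" "?z2 \<in> B2" using inj by blast+
      then have "\<forall>s\<in>S1. c (Inl s) = 0" "\<forall>s\<in>S2. c (Inr s) = 0"
        using spec[OF S1(3)[unfolded independent_mod_iff], of "\<lambda>s. c (Inl s)"]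
          spec[OF S2(3)[unfolded independent_mod_iff], of "\<lambda>s. c (Inr s)"] by simp_all
      then show "c k = 0" using k by auto
    qed (use S1 S2 Z in \<open>auto simp: image_subset_iff subset_iff\<close>)
    moreover have "n \<le> card (S1 <+> S2)"
      using S1 S2 ij(1) by (simp add: card_Plus)
    ultimately show ?thesis by (meson enat_ord_simps(1) order_trans)
  qed
  show "quotient_dim Z1 B1 + quotient_dim Z2 B2 \<le> quotient_dim Z B"
  proof (cases "quotient_dim Z B")
    case (enat m)
    then have "\<not> enat (Suc m) \<le> quotient_dim Z1 B1 + quotient_dim Z2 B2"
      using le[of "Suc m"] by auto
    then show ?thesis
      using enat by (cases "quotient_dim Z1 B1 + quotient_dim Z2 B2") auto
  qed simp
qed

lemma quotient_dim_iso:
  fixes \<phi> :: "('x \<Rightarrow> 'a::field^'n) \<Rightarrow> 'y \<Rightarrow> 'a^'n"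
  assumes "fun_vs.subspace Z1" "fun_vs.subspace B" "fun_vs.subspace B1"
    and lin: "Vector_Spaces.linear fscale fscale \<phi>"
    and "\<phi> ` Z1 \<subseteq> Z" "\<phi> ` B1 \<subseteq> B"
    and "\<And>z. z \<in> Z1 \<Longrightarrow> \<phi> z \<in> B \<Longrightarrow> z \<in> B1"
    and "\<And>z. z \<in> Z \<Longrightarrow> \<exists>z1\<in>Z1. z - \<phi> z1 \<in> B"
  shows "quotient_dim Z B = quotient_dim Z1 B1"
proof -
  have lin0: "\<phi> 0 = 0" by (rule module_hom.zero[OF module_hom_linearI[OF lin]])
  have "quotient_dim Z B = quotient_dim Z1 B1 + quotient_dim {0} {0::'x \<Rightarrow> 'a^'n}"
    by (rule quotient_dim_direct_sum[where \<phi> = \<phi> and \<psi> = \<phi>])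
      (use assms lin0 fun_vs.subspace_0[of B] fun_vs.subspace_0[of Z1] in
        \<open>auto simp: fun_vs.subspace_single_0\<close>)
  moreover have "quotient_dim {0} {0::'x \<Rightarrow> 'a^'n} \<le> enat (card ({} :: nat set))"
    by (rule quotient_dim_le_family) (auto simp: fun_vs.subspace_single_0)
  ultimately show ?thesis by (simp add: zero_enat_def[symmetric])
qed


section \<open>Face sums and the prism homotopy\<close>

text \<open>
  The simplicial coboundary \<open>(dF)(x\<^sub>0,\<dots>,x\<^sub>n) = \<Sum>\<^sub>i (-1)\<^sup>i F(\<dots>,x\<^bsub>i-1\<^esub>,x\<^bsub>i+1\<^esub>,\<dots>)\<close>, in a recursive form
  that separates the face omitting the first vertex from those keeping it. Identities between
  such alternating sums then become structural inductions over the list of vertices, with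
  \<open>F\<close> generalized to \<open>\<lambda>ys. F (x # ys)\<close>.
\<close>

fun face_sum :: "('x list \<Rightarrow> 'v::ab_group_add) \<Rightarrow> 'x list \<Rightarrow> 'v" where
  "face_sum F [] = 0"
| "face_sum F (x # xs) = F xs - face_sum (\<lambda>ys. F (x # ys)) xs"

text \<open>
  The prism operator \<open>\<Sum>\<^sub>i (-1)\<^sup>i F(x\<^sub>0,\<dots>,x\<^sub>i,p x\<^sub>i,\<dots>,p x\<^sub>n)\<close>, which triangulates the homotopy
  between the identity and a map \<open>p\<close> of vertices.
\<close>

fun prism_sum :: "('x \<Rightarrow> 'x) \<Rightarrow> ('x list \<Rightarrow> 'v::ab_group_add) \<Rightarrow> 'x list \<Rightarrow> 'v" where
  "prism_sum p F [] = 0"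
| "prism_sum p F (x # xs) = F (x # map p (x # xs)) - prism_sum p (\<lambda>ys. F (x # ys)) xs"

lemma face_sum_cong:
  assumes "\<And>ys. set ys \<subseteq> set xs \<Longrightarrow> Suc (length ys) = length xs \<Longrightarrow> F ys = F' ys"
  shows "face_sum F xs = face_sum F' xs"
  using assms
proof (induction xs arbitrary: F F')
  case (Cons x xs)
  have "face_sum (\<lambda>ys. F (x # ys)) xs = face_sum (\<lambda>ys. F' (x # ys)) xs"
    by (rule Cons.IH) (rule Cons.prems, auto)
  moreover have "F xs = F' xs" by (rule Cons.prems) auto
  ultimately show ?case by simp
qed simp

lemma prism_sum_cong:
  assumes "\<And>ys. set ys \<subseteq> set xs \<union> p ` set xs \<Longrightarrow> length ys = Suc (length xs) \<Longrightarrow> F ys = F' ys"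
  shows "prism_sum p F xs = prism_sum p F' xs"
  using assms
proof (induction xs arbitrary: F F')
  case (Cons x xs)
  have "prism_sum p (\<lambda>ys. F (x # ys)) xs = prism_sum p (\<lambda>ys. F' (x # ys)) xs"
    by (rule Cons.IH) (rule Cons.prems, auto)
  moreover have "F (x # map p (x # xs)) = F' (x # map p (x # xs))"
    by (rule Cons.prems) auto
  ultimately show ?case by simp
qed simp

lemma face_sum_diff: "face_sum (\<lambda>ys. F ys - F' ys) xs = face_sum F xs - face_sum F' xs"
  by (induction xs arbitrary: F F') simp_all

lemma face_sum_add: "face_sum (\<lambda>ys. F ys + F' ys) xs = face_sum F xs + face_sum F' xs"
  by (induction xs arbitrary: F F') simp_all

lemma prism_sum_diff: "prism_sum p (\<lambda>ys. F ys - F' ys) xs = prism_sum p F xs - prism_sum p F' xs"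
  by (induction xs arbitrary: F F') simp_all

lemma face_sum_zero: "face_sum (\<lambda>_. 0) xs = 0"
  by (induction xs) simp_all

lemma prism_sum_zero: "prism_sum p (\<lambda>_. 0) xs = 0"
  by (induction xs) simp_all

lemma face_sum_map: "face_sum F (map g xs) = face_sum (\<lambda>ys. F (map g ys)) xs"
  by (induction xs arbitrary: F) simp_all

lemma prism_sum_map:
  assumes "\<And>x. x \<in> set xs \<Longrightarrow> p (g x) = g (p x)"
  shows "prism_sum p F (map g xs) = prism_sum p (\<lambda>ys. F (map g ys)) xs"
  using assms by (induction xs arbitrary: F) (simp_all cong: map_cong)

lemma face_sum_matrix: "face_sum (\<lambda>ys. A *v F ys) xs = A *v face_sum F xs"
  for A :: "'a::field^'n^'m"
  by (induction xs arbitrary: F) (simp_all add: matrix_vector_mult_diff_distrib)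

lemma prism_sum_matrix: "prism_sum p (\<lambda>ys. A *v F ys) xs = A *v prism_sum p F xs"
  for A :: "'a::field^'n^'m"
  by (induction xs arbitrary: F) (simp_all add: matrix_vector_mult_diff_distrib)

lemma face_sum_scale: "face_sum (\<lambda>ys. c *s F ys) xs = c *s face_sum F xs"
  for c :: "'a::field"
  by (induction xs arbitrary: F) (simp_all add: vec.scale_right_diff_distrib)

lemma face_sum_explicit:
  "face_sum F xs = (\<Sum>i<length xs. (- 1) ^ i *s F (take i xs @ drop (Suc i) xs))"
  for F :: "'x list \<Rightarrow> 'a::field^'n"
proof (induction xs arbitrary: F)
  case (Cons x xs)
  show ?case
    unfolding list.size sum.lessThan_Suc_shift add_Suc_right add_0_right
    by (simp add: Cons.IH sum_negf[symmetric])
qed simp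

text \<open>
  The empty list may be treated like all others because both operators vanish on it: the
  complex is augmented by the value of \<open>F\<close> at \<open>[]\<close>. In the induction step the terms containing
  \<open>F (x # p x # \<dots>)\<close> arise in both summands and cancel by naturality of \<open>face_sum\<close>.
\<close>

lemma prism_homotopy:
  "face_sum (prism_sum p F) xs + prism_sum p (face_sum F) xs = F (map p xs) - F xs"
proof (induction xs arbitrary: F)
  case (Cons x xs)
  let ?Fx = "\<lambda>ys. F (x # ys)" and ?Fxp = "\<lambda>ys. F (x # p x # ys)"
  have "face_sum (prism_sum p F) (x # xs)
      = prism_sum p F xs - (face_sum (\<lambda>ys. ?Fxp (map p ys)) xs - face_sum (prism_sum p ?Fx) xs)"
    by (simp add: face_sum_diff)
  moreover have "prism_sum p (face_sum F) (x # xs)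
      = F (p x # map p xs) - (F (x # map p xs) - face_sum ?Fxp (map p xs))
        - (prism_sum p F xs - prism_sum p (face_sum ?Fx) xs)"
    by (simp add: prism_sum_diff)
  ultimately show ?case
    using Cons.IH[of ?Fx] by (simp add: face_sum_map algebra_simps)
qed simp


section \<open>Homogeneous cochains\<close>

text \<open>
  \<open>K\<close>-equivariant functions on the tuples of length \<open>n\<close> over a set \<open>X\<close> on which \<open>K\<close> acts by left
  multiplication. The index is the number of vertices, one more than the degree, and the space
  for \<open>n = 0\<close> is zero. In this way the coboundaries of degree \<open>0\<close> need no special case. Keeping
  \<open>K\<close> and \<open>X\<close> apart allows cochains that are equivariant under a subgroup only but are defined on
  tuples of the whole group.
\<close>

definition hom_cochains ::
  "('g, 'm) monoid_scheme \<Rightarrow> 'g set \<Rightarrow> 'g set \<Rightarrow> ('g \<Rightarrow> 'a::field^'n^'n) \<Rightarrow> nat \<Rightarrow> ('g list \<Rightarrow> 'a^'n) set" where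
  "hom_cochains G K X act n =
     {F. (\<forall>xs. F xs \<noteq> 0 \<longrightarrow> xs \<noteq> [] \<and> set xs \<subseteq> X \<and> length xs = n) \<and>
         (\<forall>k\<in>K. \<forall>xs. set xs \<subseteq> X \<longrightarrow> F (map (mult G k) xs) = act k *v F xs)}"

definition hom_coboundary :: "'g set \<Rightarrow> ('g list \<Rightarrow> 'a::field^'n) \<Rightarrow> 'g list \<Rightarrow> 'a^'n" where
  "hom_coboundary X F xs = (if set xs \<subseteq> X then face_sum F xs else 0)"

definition hom_cocycles ::
  "('g, 'm) monoid_scheme \<Rightarrow> 'g set \<Rightarrow> 'g set \<Rightarrow> ('g \<Rightarrow> 'a::field^'n^'n) \<Rightarrow> nat \<Rightarrow> ('g list \<Rightarrow> 'a^'n) set" where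
  "hom_cocycles G K X act n = {F \<in> hom_cochains G K X act n. hom_coboundary X F = 0}"

definition hom_cohomology_dim ::
  "('g, 'm) monoid_scheme \<Rightarrow> 'g set \<Rightarrow> 'g set \<Rightarrow> ('g \<Rightarrow> 'a::field^'n^'n) \<Rightarrow> nat \<Rightarrow> enat" where
  "hom_cohomology_dim G K X act q =
     quotient_dim (hom_cocycles G K X act (Suc q)) (hom_coboundary X ` hom_cochains G K X act q)"

lemma linear_fscaleI:
  fixes \<phi> :: "('x \<Rightarrow> 'a::field^'n) \<Rightarrow> 'y \<Rightarrow> 'a^'m"
  assumes "\<And>F F'. \<phi> (F + F') = \<phi> F + \<phi> F'" "\<And>c F. \<phi> (fscale c F) = fscale c (\<phi> F)"
  shows "Vector_Spaces.linear fscale fscale \<phi>"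
  unfolding Vector_Spaces.linear_iff using assms by (simp add: fun_vs.vector_space_axioms)

lemma linear_hom_coboundary:
  "Vector_Spaces.linear fscale fscale (hom_coboundary X :: ('g list \<Rightarrow> 'a::field^'n) \<Rightarrow> _)"
  by (rule linear_fscaleI)
    (auto simp: fun_eq_iff hom_coboundary_def face_sum_add face_sum_scale plus_fun_def fscale_def)

lemmas hom_coboundary_add = module_hom.add[OF module_hom_linearI[OF linear_hom_coboundary]]
  and hom_coboundary_neg = module_hom.neg[OF module_hom_linearI[OF linear_hom_coboundary]]
  and hom_coboundary_scale = module_hom.scale[OF module_hom_linearI[OF linear_hom_coboundary]]
  and hom_coboundary_0 = module_hom.zero[OF module_hom_linearI[OF linear_hom_coboundary]]

lemma subspace_hom_cochains: "fun_vs.subspace (hom_cochains G K X act n)"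
proof (rule fun_vs.subspaceI)
  fix F F' assume *: "F \<in> hom_cochains G K X act n" "F' \<in> hom_cochains G K X act n"
  have "F xs \<noteq> 0 \<or> F' xs \<noteq> 0" if "F xs + F' xs \<noteq> 0" for xs
    using that by auto
  then show "F + F' \<in> hom_cochains G K X act n"
    using * by (auto simp: hom_cochains_def matrix_vector_right_distrib; blast)
qed (auto simp: hom_cochains_def vector_scalar_commute)

lemma subspace_hom_cocycles: "fun_vs.subspace (hom_cocycles G K X act n)"
  using subspace_hom_cochains[of G K X act n]
  by (auto simp: hom_cocycles_def fun_vs.subspace_def hom_coboundary_add hom_coboundary_scale
      hom_coboundary_0)

lemma subspace_hom_coboundaries: "fun_vs.subspace (hom_coboundary X ` hom_cochains G K X act n)"
  by (rule module_hom.subspace_image[OF module_hom_linearI[OF linear_hom_coboundary]])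
    (rule subspace_hom_cochains)

lemma hom_coboundary_closed:
  assumes F: "F \<in> hom_cochains G K X act n"
    and closed: "\<And>k x. k \<in> K \<Longrightarrow> x \<in> X \<Longrightarrow> k \<otimes>\<^bsub>G\<^esub> x \<in> X"
  shows "hom_coboundary X F \<in> hom_cochains G K X act (Suc n)"
  unfolding hom_cochains_def
proof (intro CollectI conjI allI impI ballI)
  fix xs assume nz: "hom_coboundary X F xs \<noteq> 0"
  then show "xs \<noteq> []" "set xs \<subseteq> X"
    by (auto simp: hom_coboundary_def split: if_splits)
  show "length xs = Suc n"
  proof (rule ccontr)
    assume "length xs \<noteq> Suc n"
    then have "face_sum F xs = face_sum (\<lambda>_. 0) xs"
      using F by (intro face_sum_cong) (auto simp: hom_cochains_def)
    then show False using nz by (simp add: hom_coboundary_def face_sum_zero split: if_splits)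
  qed
next
  fix k xs assume k: "k \<in> K" and xs: "set xs \<subseteq> X"
  have "face_sum F (map (mult G k) xs) = face_sum (\<lambda>ys. act k *v F ys) xs"
    unfolding face_sum_map
    by (rule face_sum_cong) (use F k xs in \<open>auto simp: hom_cochains_def\<close>)
  moreover have "set (map (mult G k) xs) \<subseteq> X" using closed k xs by auto
  ultimately show "hom_coboundary X F (map (mult G k) xs) = act k *v hom_coboundary X F xs"
    using xs by (simp add: hom_coboundary_def face_sum_matrix)
qed

text \<open>
  A \<open>K\<close>-equivariant retraction \<open>p\<close> of \<open>X\<close> onto \<open>Y\<close> identifies the cohomology of the two complexes:
  restriction after pull-back along \<open>p\<close> is the identity, and the prism operator of \<open>p\<close> is a
  homotopy from the identity to pull-back after restriction. For a subgroup \<open>K = Y\<close> of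
  a group \<open>X\<close> it compares two free resolutions of the trivial \<open>K\<close>-module.
\<close>

lemma hom_cohomology_dim_retract:
  fixes act :: "'g \<Rightarrow> 'a::field^'n^'n"
  assumes YX: "Y \<subseteq> X"
    and X: "\<And>k x. k \<in> K \<Longrightarrow> x \<in> X \<Longrightarrow> k \<otimes>\<^bsub>G\<^esub> x \<in> X"
    and Y: "\<And>k y. k \<in> K \<Longrightarrow> y \<in> Y \<Longrightarrow> k \<otimes>\<^bsub>G\<^esub> y \<in> Y"
    and p: "\<And>x. x \<in> X \<Longrightarrow> p x \<in> Y" "\<And>y. y \<in> Y \<Longrightarrow> p y = y"
    and equi: "\<And>k x. k \<in> K \<Longrightarrow> x \<in> X \<Longrightarrow> p (k \<otimes>\<^bsub>G\<^esub> x) = k \<otimes>\<^bsub>G\<^esub> p x"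
  shows "hom_cohomology_dim G K X act q = hom_cohomology_dim G K Y act q"
proof -
  define pull :: "('g list \<Rightarrow> 'a^'n) \<Rightarrow> 'g list \<Rightarrow> 'a^'n"
    where "pull F xs = (if set xs \<subseteq> X then F (map p xs) else 0)" for F xs
  define res :: "('g list \<Rightarrow> 'a^'n) \<Rightarrow> 'g list \<Rightarrow> 'a^'n"
    where "res F xs = (if set xs \<subseteq> Y then F xs else 0)" for F xs
  define prism :: "('g list \<Rightarrow> 'a^'n) \<Rightarrow> 'g list \<Rightarrow> 'a^'n"
    where "prism F xs = (if set xs \<subseteq> X then prism_sum p F xs else 0)" for F xs
  have pX: "set xs \<subseteq> X \<Longrightarrow> p ` set xs \<subseteq> Y" for xs using p(1) by auto
  have lin: "Vector_Spaces.linear fscale fscale pull"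
    by (rule linear_fscaleI) (auto simp: fun_eq_iff pull_def)
  have pull_d: "pull (hom_coboundary Y F) = hom_coboundary X (pull F)" for F
  proof
    fix xs
    show "pull (hom_coboundary Y F) xs = hom_coboundary X (pull F) xs"
      using pX[of xs]
      by (auto simp: pull_def hom_coboundary_def face_sum_map intro!: face_sum_cong)
  qed
  have res_d: "res (hom_coboundary X F) = hom_coboundary Y (res F)" for F
  proof
    fix xs
    show "res (hom_coboundary X F) xs = hom_coboundary Y (res F) xs"
      using YX by (auto simp: res_def hom_coboundary_def intro!: face_sum_cong)
  qed
  have res_0: "res 0 = 0"
    by (simp add: res_def fun_eq_iff)
  have pull_cochain: "pull F \<in> hom_cochains G K X act n" if "F \<in> hom_cochains G K Y act n" for F n
    unfolding hom_cochains_def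
  proof (intro CollectI conjI allI impI ballI)
    fix xs assume "pull F xs \<noteq> 0"
    then have "set xs \<subseteq> X" "F (map p xs) \<noteq> 0" by (auto simp: pull_def split: if_splits)
    then show "xs \<noteq> []" "set xs \<subseteq> X" "length xs = n"
      using that by (auto simp: hom_cochains_def)
  next
    fix k xs assume k: "k \<in> K" and xs: "set xs \<subseteq> X"
    have "map p (map (mult G k) xs) = map (mult G k) (map p xs)"
      using equi k xs by auto
    moreover have "set (map (mult G k) xs) \<subseteq> X" using X k xs by auto
    moreover have "F (map (mult G k) (map p xs)) = act k *v F (map p xs)"
      using that k pX[OF xs] by (simp add: hom_cochains_def del: map_map)
    ultimately show "pull F (map (mult G k) xs) = act k *v pull F xs"
      using xs by (simp add: pull_def del: map_map)
  qed
  have res_cochain: "res F \<in> hom_cochains G K Y act n" if "F \<in> hom_cochains G K X act n" for F n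
    unfolding hom_cochains_def
  proof (intro CollectI conjI allI impI ballI)
    fix xs assume "res F xs \<noteq> 0"
    then show "xs \<noteq> []" "set xs \<subseteq> Y" "length xs = n"
      using that by (auto simp: hom_cochains_def res_def split: if_splits)
  next
    fix k xs assume k: "k \<in> K" and xs: "set xs \<subseteq> Y"
    moreover have "set (map (mult G k) xs) \<subseteq> Y" using Y k xs by auto
    moreover have "F (map (mult G k) xs) = act k *v F xs"
      using that k xs YX by (auto simp: hom_cochains_def)
    ultimately show "res F (map (mult G k) xs) = act k *v res F xs"
      by (simp add: res_def)
  qed
  have res_pull: "res (pull F) = F" if "F \<in> hom_cochains G K Y act n" for F n
  proof
    fix xs
    have "map p xs = xs" if "set xs \<subseteq> Y" using p(2) that by (auto intro: map_idI)
    then show "res (pull F) xs = F xs"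
      using that YX by (auto simp: res_def pull_def hom_cochains_def)
  qed
  have prism_cochain: "prism F \<in> hom_cochains G K X act n"
    if F: "F \<in> hom_cochains G K X act (Suc n)" for F n
    unfolding hom_cochains_def
  proof (intro CollectI conjI allI impI ballI)
    fix xs assume nz: "prism F xs \<noteq> 0"
    then show "xs \<noteq> []" "set xs \<subseteq> X"
      by (auto simp: prism_def split: if_splits)
    show "length xs = n"
    proof (rule ccontr)
      assume "length xs \<noteq> n"
      then have "prism_sum p F xs = prism_sum p (\<lambda>_. 0) xs"
        using F by (intro prism_sum_cong) (auto simp: hom_cochains_def)
      then show False using nz by (simp add: prism_def prism_sum_zero split: if_splits)
    qed
  next
    fix k xs assume k: "k \<in> K" and xs: "set xs \<subseteq> X"
    have "prism_sum p F (map (mult G k) xs) = prism_sum p (\<lambda>ys. F (map (mult G k) ys)) xs"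
      by (rule prism_sum_map) (use equi k xs in auto)
    also have "\<dots> = prism_sum p (\<lambda>ys. act k *v F ys) xs"
    proof (rule prism_sum_cong)
      fix ys assume "set ys \<subseteq> set xs \<union> p ` set xs"
      then have "set ys \<subseteq> X" using xs pX[OF xs] YX by auto
      then show "F (map (mult G k) ys) = act k *v F ys"
        using F k by (auto simp: hom_cochains_def)
    qed
    finally have "prism_sum p F (map (mult G k) xs) = act k *v prism_sum p F xs"
      by (simp add: prism_sum_matrix)
    moreover have "set (map (mult G k) xs) \<subseteq> X" using X k xs by auto
    ultimately show "prism F (map (mult G k) xs) = act k *v prism F xs"
      using xs by (simp add: prism_def)
  qed
  have homotopy: "F - pull (res F) = hom_coboundary X (- prism F)"
    if F: "F \<in> hom_cocycles G K X act (Suc n)" for F n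
  proof
    fix xs
    show "(F - pull (res F)) xs = hom_coboundary X (- prism F) xs"
    proof (cases "set xs \<subseteq> X")
      case True
      have "prism_sum p (face_sum F) xs = prism_sum p (hom_coboundary X F) xs"
      proof (rule prism_sum_cong)
        fix ys assume "set ys \<subseteq> set xs \<union> p ` set xs"
        then have "set ys \<subseteq> X" using True pX[OF True] YX by blast
        then show "face_sum F ys = hom_coboundary X F ys" by (simp add: hom_coboundary_def)
      qed
      also have "\<dots> = 0"
        using F by (simp add: hom_cocycles_def prism_sum_zero zero_fun_def)
      finally have "face_sum (prism_sum p F) xs = F (map p xs) - F xs"
        using prism_homotopy[of p F xs] by simp
      moreover have "face_sum (prism_sum p F) xs = hom_coboundary X (prism F) xs"
        using True by (auto simp: hom_coboundary_def prism_def intro!: face_sum_cong)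
      moreover have "pull (res F) xs = F (map p xs)"
        using True pX[OF True] by (simp add: pull_def res_def)
      ultimately show ?thesis by (simp add: hom_coboundary_neg)
    next
      case False
      then show ?thesis
        using F by (auto simp: hom_cocycles_def hom_cochains_def pull_def hom_coboundary_def)
    qed
  qed
  show ?thesis
    unfolding hom_cohomology_dim_def
  proof (rule quotient_dim_iso[OF subspace_hom_cocycles subspace_hom_coboundaries
        subspace_hom_coboundaries lin])
    show "pull ` hom_cocycles G K Y act (Suc q) \<subseteq> hom_cocycles G K X act (Suc q)"
    proof
      fix F' assume "F' \<in> pull ` hom_cocycles G K Y act (Suc q)"
      then obtain F where F: "F \<in> hom_cocycles G K Y act (Suc q)" "F' = pull F" by blast
      have "hom_coboundary X (pull F) = pull 0"
        using F(1) pull_d[of F] by (simp add: hom_cocycles_def)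
      then show "F' \<in> hom_cocycles G K X act (Suc q)"
        using F pull_cochain by (auto simp: hom_cocycles_def pull_def)
    qed
    show "pull ` hom_coboundary Y ` hom_cochains G K Y act q
        \<subseteq> hom_coboundary X ` hom_cochains G K X act q"
      using pull_d pull_cochain by auto
  next
    fix z assume z: "z \<in> hom_cocycles G K Y act (Suc q)"
      and "pull z \<in> hom_coboundary X ` hom_cochains G K X act q"
    then obtain F where F: "F \<in> hom_cochains G K X act q" "pull z = hom_coboundary X F" by blast
    have "z = res (pull z)"
      using z by (intro res_pull[symmetric]) (auto simp: hom_cocycles_def)
    also have "\<dots> = hom_coboundary Y (res F)"
      unfolding F(2) by (rule res_d)
    finally have "z = hom_coboundary Y (res F)" .
    then show "z \<in> hom_coboundary Y ` hom_cochains G K Y act q"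
      using res_cochain[OF F(1)] by blast
  next
    fix z assume z: "z \<in> hom_cocycles G K X act (Suc q)"
    have "res z \<in> hom_cocycles G K Y act (Suc q)"
      using z res_d[of z] res_cochain res_0 by (auto simp: hom_cocycles_def)
    moreover have "- prism z \<in> hom_cochains G K X act q"
      using z by (intro fun_vs.subspace_neg[OF subspace_hom_cochains] prism_cochain)
        (auto simp: hom_cocycles_def)
    ultimately show "\<exists>z1\<in>hom_cocycles G K Y act (Suc q).
        z - pull z1 \<in> hom_coboundary X ` hom_cochains G K X act q"
      using homotopy[OF z] by blast
  qed
qed


section \<open>Comparison with inhomogeneous cochains\<close>

definition group_rep :: "('g, 'm) monoid_scheme \<Rightarrow> ('g \<Rightarrow> 'a::field^'n^'n) \<Rightarrow> bool" where
  "group_rep G act \<longleftrightarrow> act \<one>\<^bsub>G\<^esub> = mat 1 \<and>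
     (\<forall>g\<in>carrier G. \<forall>h\<in>carrier G. act (g \<otimes>\<^bsub>G\<^esub> h) = act g ** act h)"

lemma group_rep_one: "group_rep G act \<Longrightarrow> act \<one>\<^bsub>G\<^esub> *v v = v"
  by (simp add: group_rep_def)

lemma group_rep_mult:
  "group_rep G act \<Longrightarrow> g \<in> carrier G \<Longrightarrow> h \<in> carrier G \<Longrightarrow>
    act (g \<otimes>\<^bsub>G\<^esub> h) *v v = act g *v (act h *v v)"
  by (simp add: group_rep_def matrix_vector_mul_assoc)

text \<open>
  The tuple \<open>(g\<^sub>1,\<dots>,g\<^sub>q)\<close> corresponds to the vertices \<open>(a, a g\<^sub>1, a g\<^sub>1 g\<^sub>2, \<dots>)\<close>, where \<open>a\<close> is free,
  and is recovered from them as the tuple of quotients of successive vertices.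
\<close>

fun partial_products :: "('g, 'm) monoid_scheme \<Rightarrow> 'g \<Rightarrow> 'g list \<Rightarrow> 'g list" where
  "partial_products G a [] = [a]"
| "partial_products G a (g # gs) = a # partial_products G (a \<otimes>\<^bsub>G\<^esub> g) gs"

fun successive_quotients :: "('g, 'm) monoid_scheme \<Rightarrow> 'g list \<Rightarrow> 'g list" where
  "successive_quotients G (x # y # xs) = (inv\<^bsub>G\<^esub> x \<otimes>\<^bsub>G\<^esub> y) # successive_quotients G (y # xs)"
| "successive_quotients G xs = []"

lemma length_partial_products [simp]: "length (partial_products G a gs) = Suc (length gs)"
  by (induction gs arbitrary: a) auto

lemma partial_products_nonempty [simp]: "partial_products G a gs \<noteq> []"
  by (cases gs) auto

lemma hd_partial_products [simp]: "hd (partial_products G a gs) = a"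
  by (cases gs) auto

lemma length_successive_quotients [simp]:
  "length (successive_quotients G xs) = length xs - 1"
  by (induction G xs rule: successive_quotients.induct) auto

lemma butlast_partial_products:
  "gs \<noteq> [] \<Longrightarrow> butlast (partial_products G a gs) = partial_products G a (butlast gs)"
  by (induction gs arbitrary: a) auto

context group
begin

lemma set_partial_products:
  "a \<in> carrier G \<Longrightarrow> set gs \<subseteq> carrier G \<Longrightarrow> set (partial_products G a gs) \<subseteq> carrier G"
  by (induction gs arbitrary: a) auto

lemma set_successive_quotients:
  "set xs \<subseteq> carrier G \<Longrightarrow> set (successive_quotients G xs) \<subseteq> carrier G"
proof (induction xs)
  case (Cons x xs)
  then show ?case by (cases xs) auto
qed simp

lemma map_mult_partial_products:
  "k \<in> carrier G \<Longrightarrow> a \<in> carrier G \<Longrightarrow> set gs \<subseteq> carrier G \<Longrightarrow>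
    map (mult G k) (partial_products G a gs) = partial_products G (k \<otimes> a) gs"
  by (induction gs arbitrary: a) (auto simp: m_assoc)

text \<open>
  Omitting an inner vertex of the simplex belonging to \<open>gs\<close> multiplies the two adjacent group
  elements; this is where the middle terms of the inhomogeneous coboundary come from.
\<close>

lemma partial_products_merge:
  assumes "Suc i < length gs" "a \<in> carrier G" "set gs \<subseteq> carrier G"
  shows "partial_products G a (merge_at G i gs)
    = take (Suc i) (partial_products G a gs) @ drop (Suc (Suc i)) (partial_products G a gs)"
  using assms
proof (induction gs arbitrary: a i)
  case (Cons g gs)
  show ?case
  proof (cases i)
    case 0
    with Cons.prems obtain h r where "gs = h # r" by (cases gs) auto
    with 0 Cons.prems show ?thesis by (cases r) (auto simp: merge_at_def m_assoc)
  next
    case (Suc j)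
    then have "merge_at G i (g # gs) = g # merge_at G j gs"
      by (simp add: merge_at_def)
    with Suc Cons show ?thesis by simp
  qed
qed simp

lemma successive_quotients_partial_products:
  "a \<in> carrier G \<Longrightarrow> set gs \<subseteq> carrier G \<Longrightarrow>
    successive_quotients G (partial_products G a gs) = gs"
proof (induction gs arbitrary: a)
  case (Cons g gs)
  have "partial_products G (a \<otimes> g) gs = (a \<otimes> g) # tl (partial_products G (a \<otimes> g) gs)"
    by (metis hd_partial_products list.collapse partial_products_nonempty)
  then have "successive_quotients G (partial_products G a (g # gs))
      = (inv a \<otimes> (a \<otimes> g)) # successive_quotients G (partial_products G (a \<otimes> g) gs)"
    by (metis partial_products.simps(2) successive_quotients.simps(1))
  then show ?case using Cons by (simp add: m_assoc[symmetric])
qed simp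

lemma partial_products_successive_quotients:
  "xs \<noteq> [] \<Longrightarrow> set xs \<subseteq> carrier G \<Longrightarrow>
    partial_products G (hd xs) (successive_quotients G xs) = xs"
proof (induction xs)
  case (Cons x xs)
  then show ?case by (cases xs) (auto simp: m_assoc[symmetric])
qed simp

lemma successive_quotients_map_mult:
  "k \<in> carrier G \<Longrightarrow> set xs \<subseteq> carrier G \<Longrightarrow>
    successive_quotients G (map (mult G k) xs) = successive_quotients G xs"
proof (induction xs)
  case (Cons x xs)
  show ?case
  proof (cases xs)
    case (Cons y ys)
    have "inv (k \<otimes> x) \<otimes> (k \<otimes> y) = inv x \<otimes> (inv k \<otimes> (k \<otimes> y))"
      using Cons.prems Cons by (simp add: inv_mult_group m_assoc)
    also have "\<dots> = inv x \<otimes> y"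
      using Cons.prems Cons by (simp add: m_assoc[symmetric])
    finally show ?thesis using Cons.IH Cons.prems Cons by simp
  qed simp
qed simp

definition dehomogenize :: "('a list \<Rightarrow> 'k::field^'n) \<Rightarrow> 'a list \<Rightarrow> 'k^'n" where
  "dehomogenize F gs = (if set gs \<subseteq> carrier G then F (partial_products G \<one> gs) else 0)"

abbreviation "equivariant_cochains act n \<equiv> hom_cochains G (carrier G) (carrier G) act n"

lemma dehomogenize_cochain:
  "F \<in> equivariant_cochains act (Suc q) \<Longrightarrow> dehomogenize F \<in> cochains G q"
  by (auto simp: cochains_def tuples_def dehomogenize_def hom_cochains_def lists_eq_set)

text \<open>
  Face by face: omitting the first vertex leaves a simplex starting at \<open>g\<^sub>1\<close>, which equivariance
  moves back to \<open>\<one>\<close> at the price of the factor \<open>act g\<^sub>1\<close>; omitting an inner vertex merges two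
  neighbours; omitting the last vertex drops the last group element.
\<close>

lemma dehomogenize_coboundary:
  fixes act :: "'a \<Rightarrow> 'k::field^'n^'n"
  assumes F: "F \<in> equivariant_cochains act (Suc q)"
  shows "dehomogenize (hom_coboundary (carrier G) F) = coboundary G act q (dehomogenize F)"
proof
  fix gs
  show "dehomogenize (hom_coboundary (carrier G) F) gs = coboundary G act q (dehomogenize F) gs"
  proof (cases "gs \<in> tuples G (Suc q)")
    case True
    then obtain g r where gs: "gs = g # r" "g \<in> carrier G" "set r \<subseteq> carrier G" "length r = q"
      by (cases gs) (auto simp: tuples_def)
    then have gsG: "set gs \<subseteq> carrier G" by simp
    let ?P = "partial_products G \<one> gs"
    have first: "F (tl ?P) = act g *v dehomogenize F r"
    proof -
      have "tl ?P = map (mult G g) (partial_products G \<one> r)"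
        using gs by (simp add: map_mult_partial_products)
      then show ?thesis
        using F gs set_partial_products[OF one_closed gs(3)]
        by (simp add: hom_cochains_def dehomogenize_def)
    qed
    have middle: "F (take (Suc i) ?P @ drop (Suc (Suc i)) ?P) = dehomogenize F (merge_at G i gs)"
      if "i < q" for i
    proof -
      have i: "Suc i < length gs" using that gs by simp
      have "gs ! i \<in> carrier G" "gs ! Suc i \<in> carrier G"
        using i gsG by (meson Suc_lessD nth_mem subsetD)+
      then have "set (merge_at G i gs) \<subseteq> carrier G"
        using gsG by (auto simp: merge_at_def dest: in_set_takeD in_set_dropD)
      then show ?thesis
        using partial_products_merge[OF i one_closed gsG] by (simp add: dehomogenize_def)
    qed
    have last: "F (take (Suc q) ?P @ drop (Suc (Suc q)) ?P) = dehomogenize F (butlast gs)"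
    proof -
      have "take (Suc q) ?P @ drop (Suc (Suc q)) ?P = butlast ?P"
        using gs by (simp add: butlast_conv_take del: partial_products.simps)
      moreover have "set (butlast gs) \<subseteq> carrier G"
        using gsG by (auto dest: in_set_butlastD)
      ultimately show ?thesis
        using gs by (simp add: dehomogenize_def butlast_partial_products del: partial_products.simps)
    qed
    have len: "length ?P = Suc (Suc q)" using gs by simp
    have "face_sum F ?P = (\<Sum>i<Suc (Suc q). (- 1) ^ i *s F (take i ?P @ drop (Suc i) ?P))"
      by (simp only: face_sum_explicit len)
    also have "\<dots> = F (tl ?P)
        + (\<Sum>i<q. (- 1) ^ Suc i *s F (take (Suc i) ?P @ drop (Suc (Suc i)) ?P))
        + (- 1) ^ Suc q *s F (take (Suc q) ?P @ drop (Suc (Suc q)) ?P)"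
      unfolding sum.lessThan_Suc[of _ "Suc q"] sum.lessThan_Suc_shift[of _ q]
      by (simp add: drop_Suc)
    also have "\<dots> = act g *v dehomogenize F r
        + (\<Sum>i<q. (- 1) ^ Suc i *s dehomogenize F (merge_at G i gs))
        + (- 1) ^ Suc q *s dehomogenize F (butlast gs)"
      using first middle last by simp
    also have "\<dots> = coboundary G act q (dehomogenize F) gs"
      using True gs(1) by (simp add: coboundary_def)
    finally show ?thesis
      using gsG set_partial_products[OF one_closed gsG]
      by (simp add: dehomogenize_def[of "hom_coboundary _ _"] hom_coboundary_def
          del: partial_products.simps)
  next
    case False
    have "hom_coboundary (carrier G) F \<in> equivariant_cochains act (Suc (Suc q))"
      by (rule hom_coboundary_closed[OF F]) simp
    then have "dehomogenize (hom_coboundary (carrier G) F) \<in> cochains G (Suc q)"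
      by (rule dehomogenize_cochain)
    with False show ?thesis by (simp add: cochains_def coboundary_def)
  qed
qed

text \<open>
  By equivariance a cochain is determined by its values on simplices starting at \<open>\<one>\<close>.
\<close>

lemma dehomogenize_injective:
  assumes act: "group_rep G act" and F: "F \<in> equivariant_cochains act n" and 0: "dehomogenize F = 0"
  shows "F = 0"
proof
  fix xs
  show "F xs = 0 xs"
  proof (rule ccontr)
    assume "F xs \<noteq> 0 xs"
    then have xs: "xs \<noteq> []" "set xs \<subseteq> carrier G" using F by (auto simp: hom_cochains_def)
    let ?gs = "successive_quotients G xs"
    have x: "hd xs \<in> carrier G" using xs by (auto simp: hd_in_set subsetD)
    have gs: "set ?gs \<subseteq> carrier G" by (rule set_successive_quotients[OF xs(2)])
    have "F (map (mult G (hd xs)) (partial_products G \<one> ?gs))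
        = act (hd xs) *v F (partial_products G \<one> ?gs)"
      using F x set_partial_products[OF one_closed gs] by (simp add: hom_cochains_def)
    moreover have "map (mult G (hd xs)) (partial_products G \<one> ?gs) = xs"
      using x gs partial_products_successive_quotients[OF xs] by (simp add: map_mult_partial_products)
    moreover have "F (partial_products G \<one> ?gs) = 0"
      using fun_cong[OF 0, of ?gs] gs by (simp add: dehomogenize_def)
    ultimately show False using \<open>F xs \<noteq> 0 xs\<close> by simp
  qed
qed

lemma dehomogenize_surjective:
  assumes act: "group_rep G act" and f: "f \<in> cochains G q"
  shows "\<exists>F\<in>equivariant_cochains act (Suc q). dehomogenize F = f"
proof
  define F where "F xs = (if xs \<noteq> [] \<and> set xs \<subseteq> carrier G
      then act (hd xs) *v f (successive_quotients G xs) else 0)" for xs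
  show "F \<in> equivariant_cochains act (Suc q)"
    unfolding hom_cochains_def
  proof (intro CollectI conjI allI impI ballI)
    fix xs assume nz: "F xs \<noteq> 0"
    then show xs: "xs \<noteq> []" "set xs \<subseteq> carrier G"
      by (auto simp: F_def split: if_splits)
    have "f (successive_quotients G xs) \<noteq> 0" using nz by (auto simp: F_def split: if_splits)
    then have "length xs - 1 = q" using f by (force simp: cochains_def tuples_def)
    then show "length xs = Suc q" using xs by (cases xs) auto
  next
    fix k xs assume k: "k \<in> carrier G" and xs: "set xs \<subseteq> carrier G"
    then have "set (map (mult G k) xs) \<subseteq> carrier G" by auto
    then show "F (map (mult G k) xs) = act k *v F xs"
      using k xs group_rep_mult[OF act, of k "hd xs"]
      by (cases "xs = []") (auto simp: F_def successive_quotients_map_mult hd_map subsetD)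
  qed
  show "dehomogenize F = f"
  proof
    fix gs
    show "dehomogenize F gs = f gs"
    proof (cases "set gs \<subseteq> carrier G")
      case True
      then show ?thesis
        using set_partial_products[OF one_closed True] group_rep_one[OF act]
        by (simp add: dehomogenize_def F_def successive_quotients_partial_products)
    next
      case False
      then show ?thesis using f by (auto simp: dehomogenize_def cochains_def tuples_def)
    qed
  qed
qed

lemma linear_dehomogenize:
  "Vector_Spaces.linear fscale fscale (dehomogenize :: ('a list \<Rightarrow> 'k::field^'n) \<Rightarrow> _)"
  by (rule linear_fscaleI) (auto simp: fun_eq_iff dehomogenize_def)

lemma dehomogenize_eq:
  assumes act: "group_rep G act" and F: "F \<in> equivariant_cochains act n" "F' \<in> equivariant_cochains act n"
    and eq: "dehomogenize F = dehomogenize F'"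
  shows "F = F'"
proof -
  have "F - F' \<in> equivariant_cochains act n"
    by (rule fun_vs.subspace_diff[OF subspace_hom_cochains F])
  moreover have "dehomogenize (F - F') = 0"
    unfolding module_hom.diff[OF module_hom_linearI[OF linear_dehomogenize]] eq by simp
  ultimately show ?thesis using dehomogenize_injective[OF act] by fastforce
qed

lemma image_dehomogenize_coboundaries:
  assumes act: "group_rep G act"
  shows "dehomogenize ` hom_coboundary (carrier G) ` equivariant_cochains act q = coboundaries G act q"
proof (cases q)
  case 0
  have "equivariant_cochains act 0 = {0}"
    by (auto simp: hom_cochains_def fun_eq_iff)
  then show ?thesis
    using module_hom.zero[OF module_hom_linearI[OF linear_dehomogenize]]
    by (simp add: 0 coboundaries_def hom_coboundary_0 zero_fun_def[symmetric])
next
  case (Suc p)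
  have "dehomogenize ` equivariant_cochains act (Suc p) = cochains G p"
    using dehomogenize_cochain dehomogenize_surjective[OF act] by (auto simp: image_iff) metis
  then have "coboundaries G act q = coboundary G act p ` dehomogenize ` equivariant_cochains act (Suc p)"
    by (simp add: Suc coboundaries_def)
  also have "\<dots> = dehomogenize ` hom_coboundary (carrier G) ` equivariant_cochains act (Suc p)"
    unfolding image_image by (intro image_cong refl) (simp add: dehomogenize_coboundary)
  finally show ?thesis by (simp add: Suc)
qed

lemma cohomology_dim_homogeneous:
  assumes act: "group_rep G act"
  shows "cohomology_dim G act q = hom_cohomology_dim G (carrier G) (carrier G) act q"
  unfolding cohomology_dim_def hom_cohomology_dim_def
proof (rule quotient_dim_iso[OF subspace_hom_cocycles _ subspace_hom_coboundaries linear_dehomogenize])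
  let ?d = "hom_coboundary (carrier G)"
  have d_closed: "?d F \<in> equivariant_cochains act (Suc n)" if "F \<in> equivariant_cochains act n" for F n
    by (rule hom_coboundary_closed[OF that]) simp
  note B = image_dehomogenize_coboundaries[OF act, of q]
  show subB: "fun_vs.subspace (coboundaries G act q)"
    unfolding B[symmetric]
    by (intro module_hom.subspace_image[OF module_hom_linearI[OF linear_dehomogenize]]
        subspace_hom_coboundaries)
  show "dehomogenize ` ?d ` equivariant_cochains act q \<subseteq> coboundaries G act q"
    using B by simp
  show "dehomogenize ` hom_cocycles G (carrier G) (carrier G) act (Suc q) \<subseteq> cocycles G act q"
  proof
    fix f assume "f \<in> dehomogenize ` hom_cocycles G (carrier G) (carrier G) act (Suc q)"
    then obtain F where F: "F \<in> equivariant_cochains act (Suc q)" "?d F = 0" "f = dehomogenize F"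
      by (auto simp: hom_cocycles_def)
    have "coboundary G act q f = dehomogenize 0"
      using dehomogenize_coboundary[OF F(1)] F by simp
    then show "f \<in> cocycles G act q"
      using dehomogenize_cochain[OF F(1)] F(3)
      by (auto simp: cocycles_def dehomogenize_def)
  qed
  show "z \<in> ?d ` equivariant_cochains act q"
    if z: "z \<in> hom_cocycles G (carrier G) (carrier G) act (Suc q)"
      and zB: "dehomogenize z \<in> coboundaries G act q" for z
  proof -
    obtain F where F: "F \<in> equivariant_cochains act q" "dehomogenize z = dehomogenize (?d F)"
      using zB unfolding B[symmetric] by blast
    then have "z = ?d F"
      using z by (intro dehomogenize_eq[OF act _ d_closed[OF F(1)]]) (auto simp: hom_cocycles_def)
    then show ?thesis using F(1) by blast
  qed
  show "\<exists>z1\<in>hom_cocycles G (carrier G) (carrier G) act (Suc q). z - dehomogenize z1 \<in> coboundaries G act q"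
    if z: "z \<in> cocycles G act q" for z
  proof -
    have zc: "z \<in> cochains G q" "coboundary G act q z = 0"
      using z by (auto simp: cocycles_def zero_fun_def)
    obtain F where F: "F \<in> equivariant_cochains act (Suc q)" "dehomogenize F = z"
      using dehomogenize_surjective[OF act zc(1)] by blast
    have "dehomogenize (?d F) = 0"
      using dehomogenize_coboundary[OF F(1)] F(2) zc(2) by simp
    then have "?d F = 0"
      by (rule dehomogenize_injective[OF act d_closed[OF F(1)]])
    then show ?thesis
      using F fun_vs.subspace_0[OF subB] by (intro bexI[of _ F]) (auto simp: hom_cocycles_def)
  qed
qed

end


section \<open>Subgroups of index two\<close>

text \<open>
  A character with values \<open>\<plusminus>1\<close> that takes the value \<open>-1\<close> at some \<open>s\<close>. It takes values in the field
  of coefficients, where it can serve as a scalar, and its kernel has index two.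
\<close>

locale index_two_character = group G for G (structure) +
  fixes sgn_char :: "'a \<Rightarrow> 'k::field" and s :: 'a
  assumes sgn_mult: "x \<in> carrier G \<Longrightarrow> y \<in> carrier G \<Longrightarrow> sgn_char (x \<otimes> y) = sgn_char x * sgn_char y"
    and sgn_values: "x \<in> carrier G \<Longrightarrow> sgn_char x = 1 \<or> sgn_char x = - 1"
    and s_closed [simp]: "s \<in> carrier G" and sgn_s: "sgn_char s = - 1"
    and two_nonzero: "(2::'k) \<noteq> 0"
begin

definition sgn_kernel :: "'a set" where
  "sgn_kernel = {x \<in> carrier G. sgn_char x = 1}"

lemma one_neq_minus_one: "(1::'k) \<noteq> - 1"
  using two_nonzero by (metis eq_neg_iff_add_eq_0 one_add_one)

lemma sgn_one: "sgn_char \<one> = 1"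
  using sgn_mult[of \<one> \<one>] sgn_values[of \<one>] by auto

lemma sgn_inv: "x \<in> carrier G \<Longrightarrow> sgn_char (inv x) = sgn_char x"
  using sgn_mult[of x "inv x"] sgn_values[of x] by (auto simp: sgn_one minus_equation_iff)

lemma subgroup_sgn_kernel: "subgroup sgn_kernel G"
  by (rule subgroupI) (auto simp: sgn_kernel_def sgn_mult sgn_inv sgn_one intro: exI[of _ \<one>])

text \<open>
  Right translation by the inverse of \<open>s\<close> maps the nontrivial coset onto the kernel and commutes
  with left multiplication, so it gives an equivariant retraction of the group onto the kernel.
\<close>

lemma hom_cohomology_dim_kernel:
  "hom_cohomology_dim G sgn_kernel (carrier G) act q = hom_cohomology_dim G sgn_kernel sgn_kernel act q"
proof -
  have "- sgn_char x = 1" if "x \<in> carrier G" "sgn_char x \<noteq> 1" for x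
    using sgn_values[OF that(1)] that(2) by simp
  then show ?thesis
    by (intro hom_cohomology_dim_retract[where p = "\<lambda>x. if sgn_char x = 1 then x else x \<otimes> inv s"])
      (auto simp: sgn_kernel_def sgn_mult sgn_inv sgn_s m_assoc)
qed

context
  fixes act act' :: "'a \<Rightarrow> 'k^'n^'n"
  assumes act: "group_rep G act"
    and twist: "\<And>g v. g \<in> carrier G \<Longrightarrow> act' g *v v = sgn_char g *s (act g *v v)"
begin

text \<open>
  The action of the class of \<open>s\<close> on the cochains that are equivariant under the kernel. It
  is an involution, although \<open>s\<close> need not be one, because the square of \<open>s\<close> lies in the kernel. Its eigenspaces
  for \<open>1\<close> and \<open>-1\<close> are the equivariant cochains with values in \<open>act\<close> and in its twist; the
  following half sum and half difference are the projections onto them.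
\<close>

definition translate :: "('a list \<Rightarrow> 'k^'n) \<Rightarrow> 'a list \<Rightarrow> 'k^'n" where
  "translate F xs = (if set xs \<subseteq> carrier G then act s *v F (map (mult G (inv s)) xs) else 0)"

definition half_sum :: "('a list \<Rightarrow> 'k^'n) \<Rightarrow> 'a list \<Rightarrow> 'k^'n" where
  "half_sum F xs = (1 / 2) *s (F xs + translate F xs)"

definition half_difference :: "('a list \<Rightarrow> 'k^'n) \<Rightarrow> 'a list \<Rightarrow> 'k^'n" where
  "half_difference F xs = (1 / 2) *s (F xs - translate F xs)"

lemma half_sum_difference: "F = half_sum F + half_difference F"
  using two_nonzero
  by (auto simp: half_sum_def half_difference_def fun_eq_iff vec_eq_iff field_simps)

lemma map_mult_mult:
  "a \<in> carrier G \<Longrightarrow> b \<in> carrier G \<Longrightarrow> set xs \<subseteq> carrier G \<Longrightarrow>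
    map (mult G a) (map (mult G b) xs) = map (mult G (a \<otimes> b)) xs"
  by (auto simp: m_assoc subset_iff)

lemma set_map_mult:
  "a \<in> carrier G \<Longrightarrow> set xs \<subseteq> carrier G \<Longrightarrow> set (map (mult G a) xs) \<subseteq> carrier G"
  by auto

text \<open>
  An element \<open>g\<close> outside the kernel can be written \<open>(g s) s\<^sup>-\<^sup>1\<close> with \<open>g s\<close> in the kernel, so
  equivariance under the kernel determines how such a \<open>g\<close> acts: up to \<open>act g\<close>, it interchanges
  \<open>F\<close> with its translate.
\<close>

lemma kernel_cochain_translate:
  assumes F: "F \<in> hom_cochains G sgn_kernel (carrier G) act n"
    and g: "g \<in> carrier G" and xs: "set xs \<subseteq> carrier G"
  shows "F (map (mult G g) xs) = act g *v (if sgn_char g = 1 then F xs else translate F xs)"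
    and "translate F (map (mult G g) xs) = act g *v (if sgn_char g = 1 then translate F xs else F xs)"
proof -
  have FH: "F (map (mult G h) ys) = act h *v F ys"
    if "h \<in> carrier G" "sgn_char h = 1" "set ys \<subseteq> carrier G" for h ys
    using F that by (auto simp: hom_cochains_def sgn_kernel_def)
  note gs = set_map_mult[OF g xs]
  show 1: "F (map (mult G g) xs) = act g *v (if sgn_char g = 1 then F xs else translate F xs)"
  proof (cases "sgn_char g = 1")
    case True
    then show ?thesis using FH[OF g True xs] by simp
  next
    case False
    then have sg: "sgn_char (g \<otimes> s) = 1"
      using sgn_values[OF g] g by (simp add: sgn_mult sgn_s)
    have "map (mult G g) xs = map (mult G (g \<otimes> s)) (map (mult G (inv s)) xs)"
      using g xs by (simp add: map_mult_mult m_assoc del: map_map)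
    then have "F (map (mult G g) xs) = act (g \<otimes> s) *v F (map (mult G (inv s)) xs)"
      using FH[OF _ sg set_map_mult[OF _ xs]] g by (simp del: map_map)
    then show ?thesis
      using False g xs by (simp add: translate_def group_rep_mult[OF act])
  qed
  show "translate F (map (mult G g) xs) = act g *v (if sgn_char g = 1 then translate F xs else F xs)"
  proof (cases "sgn_char g = 1")
    case True
    have "map (mult G (inv s)) (map (mult G g) xs)
        = map (mult G (inv s \<otimes> g \<otimes> s)) (map (mult G (inv s)) xs)"
      using g xs by (simp add: map_mult_mult m_assoc del: map_map)
    moreover have "sgn_char (inv s \<otimes> g \<otimes> s) = 1"
      using g True by (simp add: sgn_mult sgn_inv sgn_s)
    ultimately have "F (map (mult G (inv s)) (map (mult G g) xs))
        = act (inv s \<otimes> g \<otimes> s) *v F (map (mult G (inv s)) xs)"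
      using FH[OF _ _ set_map_mult[OF _ xs]] g by (simp del: map_map)
    then have "translate F (map (mult G g) xs)
        = act (s \<otimes> (inv s \<otimes> g \<otimes> s)) *v F (map (mult G (inv s)) xs)"
      using g gs by (simp add: translate_def group_rep_mult[OF act] del: map_map)
    also have "s \<otimes> (inv s \<otimes> g \<otimes> s) = g \<otimes> s"
      using g by (simp add: m_assoc[symmetric])
    finally show ?thesis
      using True g xs by (simp add: translate_def group_rep_mult[OF act])
  next
    case False
    have "sgn_char (inv s \<otimes> g) = 1"
      using g False sgn_values[OF g] by (simp add: sgn_mult sgn_inv sgn_s)
    then have "F (map (mult G (inv s)) (map (mult G g) xs)) = act (inv s \<otimes> g) *v F xs"
      using FH[OF _ _ xs, of "inv s \<otimes> g"] g xs by (simp add: map_mult_mult del: map_map)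
    then have "translate F (map (mult G g) xs) = act (s \<otimes> (inv s \<otimes> g)) *v F xs"
      using g gs by (simp add: translate_def group_rep_mult[OF act] del: map_map)
    also have "s \<otimes> (inv s \<otimes> g) = g"
      using g by (simp add: m_assoc[symmetric])
    finally show ?thesis using False by simp
  qed
qed

lemma half_cochains:
  assumes F: "F \<in> hom_cochains G sgn_kernel (carrier G) act n"
  shows "half_sum F \<in> equivariant_cochains act n"
    and "half_difference F \<in> equivariant_cochains act' n"
proof -
  have supp: "xs \<noteq> [] \<and> set xs \<subseteq> carrier G \<and> length xs = n" if "F xs \<noteq> 0 \<or> translate F xs \<noteq> 0" for xs
  proof (cases "F xs = 0")
    case True
    then have "set xs \<subseteq> carrier G" "F (map (mult G (inv s)) xs) \<noteq> 0"
      using that by (auto simp: translate_def split: if_splits)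
    then show ?thesis using F by (auto simp: hom_cochains_def)
  qed (use F in \<open>auto simp: hom_cochains_def\<close>)
  note tr = kernel_cochain_translate[OF F]
  show "half_sum F \<in> equivariant_cochains act n"
    unfolding hom_cochains_def
  proof (intro CollectI conjI allI impI ballI)
    fix g xs assume "g \<in> carrier G" "set xs \<subseteq> carrier G"
    then show "half_sum F (map (mult G g) xs) = act g *v half_sum F xs"
      by (simp add: half_sum_def tr vector_scalar_commute matrix_vector_right_distrib add.commute)
  next
    fix xs assume "half_sum F xs \<noteq> 0"
    then have "F xs \<noteq> 0 \<or> translate F xs \<noteq> 0" by (auto simp: half_sum_def)
    then show "xs \<noteq> []" "set xs \<subseteq> carrier G" "length xs = n" using supp by blast+
  qed
  show "half_difference F \<in> equivariant_cochains act' n"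
    unfolding hom_cochains_def
  proof (intro CollectI conjI allI impI ballI)
    fix g xs assume g: "g \<in> carrier G" and "set xs \<subseteq> carrier G"
    then show "half_difference F (map (mult G g) xs) = act' g *v half_difference F xs"
      using sgn_values[OF g] one_neq_minus_one
      by (auto simp: half_difference_def tr twist vector_scalar_commute matrix_vector_mult_diff_distrib
          vec_eq_iff algebra_simps)
  next
    fix xs assume "half_difference F xs \<noteq> 0"
    then have "F xs \<noteq> 0 \<or> translate F xs \<noteq> 0" by (auto simp: half_difference_def)
    then show "xs \<noteq> []" "set xs \<subseteq> carrier G" "length xs = n" using supp by blast+
  qed
qed

lemma equivariant_in_kernel_cochains:
  "equivariant_cochains act n \<subseteq> hom_cochains G sgn_kernel (carrier G) act n"
  "equivariant_cochains act' n \<subseteq> hom_cochains G sgn_kernel (carrier G) act n"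
  by (auto simp: hom_cochains_def sgn_kernel_def twist)

text \<open>
  A common element satisfies \<open>F (s xs) = act s *v F xs\<close> and \<open>F (s xs) = - (act s *v F xs)\<close>,
  and \<open>2\<close> and \<open>act s\<close> are invertible.
\<close>

lemma equivariant_cochains_disjoint:
  assumes F: "F \<in> equivariant_cochains act n" "F \<in> equivariant_cochains act' n"
  shows "F = 0"
proof
  fix xs
  show "F xs = 0 xs"
  proof (cases "set xs \<subseteq> carrier G")
    case True
    have "act s *v F xs = - (act s *v F xs)"
      using F True s_closed twist[OF s_closed, of "F xs"] by (auto simp: hom_cochains_def sgn_s)
    then have "2 *s (act s *v F xs) = 0"
      by (metis add.right_inverse one_add_one vec.scale_left_distrib vec.scale_one)
    then have "act s *v F xs = 0"
      using two_nonzero by simp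
    then have "act (inv s) *v (act s *v F xs) = 0" by simp
    then show ?thesis
      using group_rep_mult[OF act, of "inv s" s "F xs"] group_rep_one[OF act] by simp
  next
    case False
    then show ?thesis using F by (auto simp: hom_cochains_def)
  qed
qed

text \<open>
  The decomposition holds for cochains and is respected by the coboundary, hence it passes to
  cohomology; both comparison maps are inclusions.
\<close>

lemma hom_cohomology_dim_split:
  "hom_cohomology_dim G sgn_kernel (carrier G) act q
    = hom_cohomology_dim G (carrier G) (carrier G) act q
      + hom_cohomology_dim G (carrier G) (carrier G) act' q"
proof -
  let ?d = "hom_coboundary (carrier G) :: ('a list \<Rightarrow> 'k^'n) \<Rightarrow> _"
  have lin: "Vector_Spaces.linear fscale fscale (\<lambda>F :: 'a list \<Rightarrow> 'k^'n. F)"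
    by (rule linear_fscaleI) auto
  have d_act: "?d F \<in> equivariant_cochains act (Suc n)" if "F \<in> equivariant_cochains act n" for F n
    by (rule hom_coboundary_closed[OF that]) simp
  have d_act': "?d F \<in> equivariant_cochains act' (Suc n)" if "F \<in> equivariant_cochains act' n" for F n
    by (rule hom_coboundary_closed[OF that]) simp
  show ?thesis
    unfolding hom_cohomology_dim_def
  proof (rule quotient_dim_direct_sum[OF subspace_hom_cocycles subspace_hom_cocycles
        subspace_hom_coboundaries subspace_hom_coboundaries subspace_hom_coboundaries lin lin])
    fix z1 z2 assume z: "z1 \<in> hom_cocycles G (carrier G) (carrier G) act (Suc q)"
      "z2 \<in> hom_cocycles G (carrier G) (carrier G) act' (Suc q)"
      and "z1 + z2 \<in> ?d ` hom_cochains G sgn_kernel (carrier G) act q"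
    then obtain F where F: "F \<in> hom_cochains G sgn_kernel (carrier G) act q" "z1 + z2 = ?d F"
      by blast
    note F12 = half_cochains[OF F(1)]
    have "?d F = ?d (half_sum F) + ?d (half_difference F)"
      by (subst half_sum_difference[of F]) (rule hom_coboundary_add)
    then have eq: "z1 - ?d (half_sum F) = ?d (half_difference F) - z2"
      using F(2) by (simp add: algebra_simps)
    have "z1 - ?d (half_sum F) \<in> equivariant_cochains act (Suc q)"
      using z(1) d_act[OF F12(1)]
      by (intro fun_vs.subspace_diff[OF subspace_hom_cochains]) (auto simp: hom_cocycles_def)
    moreover have "?d (half_difference F) - z2 \<in> equivariant_cochains act' (Suc q)"
      using z(2) d_act'[OF F12(2)]
      by (intro fun_vs.subspace_diff[OF subspace_hom_cochains]) (auto simp: hom_cocycles_def)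
    ultimately have "z1 - ?d (half_sum F) = 0"
      unfolding eq[symmetric] by (rule equivariant_cochains_disjoint)
    then have "z1 = ?d (half_sum F)" "z2 = ?d (half_difference F)"
      using eq by simp_all
    then show "z1 \<in> ?d ` equivariant_cochains act q \<and> z2 \<in> ?d ` equivariant_cochains act' q"
      using F12 by blast
  next
    fix z assume z: "z \<in> hom_cocycles G sgn_kernel (carrier G) act (Suc q)"
    then have zc: "z \<in> hom_cochains G sgn_kernel (carrier G) act (Suc q)" "?d z = 0"
      by (auto simp: hom_cocycles_def)
    note z12 = half_cochains[OF zc(1)]
    have "?d (half_sum z) + ?d (half_difference z) = 0"
      using zc(2) hom_coboundary_add[of "carrier G" "half_sum z" "half_difference z"]
        half_sum_difference[of z] by simp
    then have eq: "?d (half_sum z) = - ?d (half_difference z)"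
      by (simp add: eq_neg_iff_add_eq_0)
    have "?d (half_sum z) = 0"
    proof (rule equivariant_cochains_disjoint)
      show "?d (half_sum z) \<in> equivariant_cochains act' (Suc (Suc q))"
        unfolding eq by (rule fun_vs.subspace_neg[OF subspace_hom_cochains d_act'[OF z12(2)]])
    qed (rule d_act[OF z12(1)])
    then have "half_sum z \<in> hom_cocycles G (carrier G) (carrier G) act (Suc q)"
      "half_difference z \<in> hom_cocycles G (carrier G) (carrier G) act' (Suc q)"
      using z12 eq by (auto simp: hom_cocycles_def)
    moreover have "z - (half_sum z + half_difference z) \<in> ?d ` hom_cochains G sgn_kernel (carrier G) act q"
      using half_sum_difference[of z] fun_vs.subspace_0[OF subspace_hom_coboundaries] by simp
    ultimately show "\<exists>z1\<in>hom_cocycles G (carrier G) (carrier G) act (Suc q).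
        \<exists>z2\<in>hom_cocycles G (carrier G) (carrier G) act' (Suc q).
        z - (z1 + z2) \<in> ?d ` hom_cochains G sgn_kernel (carrier G) act q"
      by blast
  qed (auto simp: hom_cocycles_def intro!: imageI
      dest: subsetD[OF equivariant_in_kernel_cochains(1)] subsetD[OF equivariant_in_kernel_cochains(2)])
qed

text \<open>
  Shapiro's lemma for the kernel of the character: the representation induced from the
  restriction of \<open>act\<close> to the kernel is the sum of \<open>act\<close> and its twist. The middle step is the
  complex of cochains on the whole group that are equivariant under the kernel only.
\<close>

theorem cohomology_dim_index_two:
  "cohomology_dim (G\<lparr>carrier := sgn_kernel\<rparr>) act q = cohomology_dim G act q + cohomology_dim G act' q"
proof -
  interpret H: group "G\<lparr>carrier := sgn_kernel\<rparr>"
    by (rule subgroup_imp_group[OF subgroup_sgn_kernel])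
  have act': "group_rep G act'"
    unfolding group_rep_def matrix_eq
    using group_rep_one[OF act]
    by (simp add: twist sgn_one sgn_mult group_rep_mult[OF act] matrix_vector_mul_assoc[symmetric]
        vector_scalar_commute mult.commute)
  have "group_rep (G\<lparr>carrier := sgn_kernel\<rparr>) act"
    using act by (auto simp: group_rep_def sgn_kernel_def)
  then have "cohomology_dim (G\<lparr>carrier := sgn_kernel\<rparr>) act q
      = hom_cohomology_dim (G\<lparr>carrier := sgn_kernel\<rparr>) sgn_kernel sgn_kernel act q"
    using H.cohomology_dim_homogeneous by simp
  also have "\<dots> = hom_cohomology_dim G sgn_kernel sgn_kernel act q"
    by (simp add: hom_cohomology_dim_def hom_cocycles_def hom_cochains_def)
  finally show ?thesis
    using hom_cohomology_dim_kernel[of act q] hom_cohomology_dim_split[of q]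
      cohomology_dim_homogeneous[OF act] cohomology_dim_homogeneous[OF act'] by simp
qed

end

end


lemma cohomology_dim_cong:
  assumes "\<And>g. g \<in> carrier G \<Longrightarrow> act g = act' g"
  shows "cohomology_dim G act q = cohomology_dim G act' q"
proof -
  have "coboundary G act p f = coboundary G act' p f" for p f
  proof
    fix gs
    have "hd gs \<in> carrier G" if "gs \<in> tuples G (Suc p)"
      using that by (cases gs) (auto simp: tuples_def)
    then show "coboundary G act p f gs = coboundary G act' p f gs"
      using assms by (auto simp: coboundary_def)
  qed
  then show ?thesis
    by (simp add: cohomology_dim_def cocycles_def coboundaries_def fun_eq_iff[of "coboundary G _ _"]
        cong: nat.case_cong)
qed


section \<open>Integer matrices\<close>

lemma map_matrix_of_int_mult:
  "(map_matrix of_int (A ** B) :: 'a::comm_ring_1^'n^'m) = map_matrix of_int A ** map_matrix of_int B"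
  by (simp add: vec_eq_iff matrix_matrix_mult_def)

lemma map_matrix_of_int_one: "(map_matrix of_int (mat 1) :: 'a::comm_ring_1^'n^'n) = mat 1"
  by (simp add: vec_eq_iff mat_def)

lemma det_map_matrix_of_int: "(det (map_matrix of_int A) :: 'a::comm_ring_1) = of_int (det A)"
  by (simp add: det_def)

lemma inj_map_matrix_of_int:
  "(map_matrix of_int A :: 'a::ring_char_0^'n^'m) = map_matrix of_int B \<Longrightarrow> A = B"
  by (simp add: vec_eq_iff)

text \<open>
  By Cramer's rule the inverse over the rationals has the entries \<open>det C / det A\<close> with integer
  matrices \<open>C\<close>; these are integers if \<open>det A\<close> is \<open>1\<close> or \<open>-1\<close>.
\<close>

lemma invertible_int_matrix_iff:
  fixes A :: "int^'n^'n"
  shows "invertible A \<longleftrightarrow> det A = 1 \<or> det A = - 1"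
proof
  assume "invertible A"
  then obtain B where "A ** B = mat 1" by (auto simp: invertible_def)
  then have "det A * det B = 1" by (metis det_I det_mul)
  then show "det A = 1 \<or> det A = - 1" by (auto simp: zmult_eq_1_iff)
next
  assume d: "det A = 1 \<or> det A = - 1"
  let ?R = "map_matrix of_int A :: rat^'n^'n"
  have dR: "det ?R = of_int (det A)" by (rule det_map_matrix_of_int)
  then have nz: "det ?R \<noteq> 0" using d by auto
  define C where "C k j = (\<chi> i l. if l = k then mat 1 $ i $ j else A $ i $ l)" for k j :: 'n
  \<comment> \<open>Multiplying by \<open>det A\<close> is the same as dividing by it.\<close>
  define B where "B = (\<chi> k j. det A * det (C k j))"
  have "?R ** map_matrix of_int B = mat 1"
    unfolding vec_eq_iff
  proof (intro allI)
    fix i j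
    define b :: "rat^'n" where "b = (\<chi> i. mat 1 $ i $ j)"
    have C: "(\<chi> i l. if l = k then b $ i else ?R $ i $ l) = map_matrix of_int (C k j)" for k
      by (simp add: vec_eq_iff C_def b_def mat_def)
    have sol: "(\<chi> k. det (\<chi> i l. if l = k then b $ i else ?R $ i $ l) / det ?R)
        = (\<chi> k. map_matrix of_int B $ k $ j)"
      unfolding C dR det_map_matrix_of_int using d by (auto simp: vec_eq_iff B_def)
    have "?R *v (\<chi> k. map_matrix of_int B $ k $ j) = b"
      by (rule iffD2[OF cramer[OF nz] sol[symmetric]])
    then have "(?R *v (\<chi> k. map_matrix of_int B $ k $ j)) $ i = mat 1 $ i $ j"
      by (simp add: b_def)
    then show "(?R ** map_matrix of_int B) $ i $ j = mat 1 $ i $ j"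
      by (simp add: matrix_matrix_mult_def matrix_vector_mult_def)
  qed
  then have "?R ** map_matrix of_int B = mat 1" "map_matrix of_int B ** ?R = mat 1"
    using matrix_left_right_inverse by blast+
  then have "(map_matrix of_int (A ** B) :: rat^'n^'n) = map_matrix of_int (mat 1)"
    "(map_matrix of_int (B ** A) :: rat^'n^'n) = map_matrix of_int (mat 1)"
    by (simp_all only: map_matrix_of_int_mult map_matrix_of_int_one)
  then have "A ** B = mat 1" "B ** A = mat 1"
    by (auto dest: inj_map_matrix_of_int)
  then show "invertible A" by (auto simp: invertible_def)
qed

lemma group_GL4_Z: "group GL4_Z"
proof (rule groupI)
  fix A assume "A \<in> carrier GL4_Z"
  then obtain B where "A ** B = mat 1" "B ** A = mat 1"
    by (auto simp: GL4_Z_def invertible_def)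
  then show "\<exists>B\<in>carrier GL4_Z. B \<otimes>\<^bsub>GL4_Z\<^esub> A = \<one>\<^bsub>GL4_Z\<^esub>"
    by (intro bexI[of _ B]) (auto simp: GL4_Z_def invertible_def)
qed (auto simp: GL4_Z_def matrix_mul_assoc invertible_int_matrix_iff det_mul)

definition reflection :: "int^4^4" where
  "reflection = (\<chi> i j. if i = j then if i = 0 then - 1 else 1 else 0)"

lemma det_reflection: "det reflection = - 1"
proof -
  have "det reflection = (\<Prod>i\<in>UNIV. reflection $ i $ i)"
    by (rule det_diagonal) (simp add: reflection_def)
  then show ?thesis by (simp add: reflection_def)
qed

interpretation GL4_Z: index_two_character GL4_Z "\<lambda>A. of_int (det A) :: rat" reflection
  by (intro index_two_character.intro index_two_character_axioms.intro group_GL4_Z)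
    (auto simp: GL4_Z_def det_mul invertible_int_matrix_iff det_reflection)

lemma SL4_Z_eq_kernel: "SL4_Z = GL4_Z\<lparr>carrier := GL4_Z.sgn_kernel\<rparr>"
  unfolding GL4_Z.sgn_kernel_def
  by (auto simp: SL4_Z_def GL4_Z_def invertible_int_matrix_iff)

lemma map_matrix_GL4_Q: "A \<in> carrier GL4_Z \<Longrightarrow> map_matrix of_int A \<in> GL4_Q"
  by (auto simp: GL4_Z_def GL4_Q_def invertible_int_matrix_iff invertible_det_nz det_map_matrix_of_int)

lemma map_matrix_SL4_Q: "A \<in> carrier SL4_Z \<Longrightarrow> map_matrix of_int A \<in> SL4_Q"
  by (simp add: SL4_Z_def SL4_Q_def det_map_matrix_of_int)

lemma mat_mult_vec: "(mat c ** A) *v v = c *s (A *v v)"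
  for A :: "'a::field^'n^'n"
proof -
  have "mat c *v w = c *s w" for w :: "'a^'n"
    by (simp add: vec_eq_iff matrix_vector_mult_def mat_def if_distrib[of "\<lambda>x. x * _"] cong: if_cong)
  then show ?thesis by (simp add: matrix_vector_mul_assoc[symmetric])
qed

text \<open>
  For \<open>GL\<^sub>4(\<int>)\<close> with the determinant as character, the kernel is \<open>SL\<^sub>4(\<int>)\<close> and the twist is the
  tensor product with the determinant.
\<close>

theorem betti_SL_decomposition:
  fixes M Mt :: "rat^4^4 \<Rightarrow> rat^'n^'n"
  assumes Mt: "polynomial_rep GL4_Q Mt" and extends: "\<forall>A\<in>SL4_Q. Mt A = M A"
  shows "betti_SL M q = cohomology_dim GL4_Z (restrict_Z (det_twist 0 Mt)) q
    + cohomology_dim GL4_Z (restrict_Z (det_twist 1 Mt)) q"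
proof -
  have rep: "group_rep GL4_Z (restrict_Z Mt)"
    using Mt map_matrix_GL4_Q
    by (auto simp: group_rep_def polynomial_rep_def restrict_Z_def GL4_Z_def map_matrix_of_int_one
        map_matrix_of_int_mult)
  have "betti_SL M q = cohomology_dim SL4_Z (restrict_Z Mt) q"
    unfolding betti_SL_def
    by (rule cohomology_dim_cong) (simp add: restrict_Z_def extends map_matrix_SL4_Q)
  also have "\<dots> = cohomology_dim GL4_Z (restrict_Z Mt) q
      + cohomology_dim GL4_Z (restrict_Z (det_twist 1 Mt)) q"
    unfolding SL4_Z_eq_kernel
    by (rule GL4_Z.cohomology_dim_index_two[OF rep])
      (simp add: restrict_Z_def det_twist_def mat_mult_vec det_map_matrix_of_int)
  also have "restrict_Z Mt = restrict_Z (det_twist 0 Mt)"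
    by (simp add: restrict_Z_def det_twist_def fun_eq_iff)
  finally show ?thesis .
qed


section \<open>Euler characteristics\<close>

lemma finite_support_of_suminf:
  fixes b :: "nat \<Rightarrow> enat"
  assumes "(\<Sum>q. b q) \<noteq> \<infinity>"
  shows "finite {q. b q \<noteq> 0}" and "b q \<noteq> \<infinity>"
proof -
  have le: "sum b I \<le> (\<Sum>q. b q)" if "finite I" for I
    using that by (intro sum_le_suminf) auto
  obtain m where m: "(\<Sum>q. b q) = enat m" using assms by auto
  have "b q \<le> enat m" using le[of "{q}"] m by simp
  then show "b q \<noteq> \<infinity>" by (cases "b q") auto
  have "card I \<le> m" if I: "I \<subseteq> {q. b q \<noteq> 0}" "finite I" for I
  proof -
    have "1 \<le> b q" if "q \<in> I" for q
      using I(1) that by (cases "b q") (auto simp: one_enat_def zero_enat_def)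
    then have "(\<Sum>q\<in>I. 1) \<le> sum b I" by (intro sum_mono) auto
    then show ?thesis using le[OF I(2)] m by (simp add: of_nat_eq_enat) (meson enat_ord_simps(1) order_trans)
  qed
  then show "finite {q. b q \<noteq> 0}"
    using finite_if_finite_subsets_card_bdd[of "{q. b q \<noteq> 0}" m] by blast
qed

lemma euler_char_eq_sum:
  assumes "(\<Sum>q. b q) \<noteq> \<infinity>" "finite Q" "{q. b q \<noteq> 0} \<subseteq> Q"
  shows "euler_char b = (\<Sum>q\<in>Q. (- 1) ^ q * int (the_enat (b q)))"
proof -
  have "(\<Sum>q | b q \<noteq> 0. (- 1) ^ q * int (the_enat (b q))) = (\<Sum>q\<in>Q. (- 1) ^ q * int (the_enat (b q)))"
    using assms(2,3) by (intro sum.mono_neutral_left) (auto simp: zero_enat_def)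
  then show ?thesis using assms(1) unfolding euler_char_def by (simp only: if_False)
qed

lemma enat_sum: "(\<Sum>q\<in>Q. enat (f q)) = enat (\<Sum>q\<in>Q. f q)"
  by (induction Q rule: infinite_finite_induct) (auto simp: zero_enat_def)

text \<open>
  If the total dimension is infinite, then \<open>b\<close> has Euler characteristic \<open>0\<close> by convention and
  both bounds are trivial. Otherwise \<open>a\<close> and \<open>c\<close> are finite with support inside that of \<open>b\<close>, all
  three characteristics are sums over this support, and both bounds are triangle inequalities.
\<close>

lemma euler_char_add:
  assumes b: "\<And>q. b q = a q + c q"
  shows "enat (nat (\<bar>euler_char a\<bar> + \<bar>euler_char c\<bar>)) \<le> (\<Sum>q. b q)"
    and "\<bar>euler_char b\<bar> \<le> \<bar>euler_char a\<bar> + \<bar>euler_char c\<bar>"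
proof -
  have "enat (nat (\<bar>euler_char a\<bar> + \<bar>euler_char c\<bar>)) \<le> (\<Sum>q. b q) \<and>
    \<bar>euler_char b\<bar> \<le> \<bar>euler_char a\<bar> + \<bar>euler_char c\<bar>"
  proof (cases "(\<Sum>q. b q) = \<infinity>")
    case True
    then show ?thesis by (simp add: euler_char_def)
  next
    case False
    have "(\<Sum>q. a q) \<le> (\<Sum>q. b q)" "(\<Sum>q. c q) \<le> (\<Sum>q. b q)"
      by (auto intro!: suminf_le simp: b)
    then have ac: "(\<Sum>q. a q) \<noteq> \<infinity>" "(\<Sum>q. c q) \<noteq> \<infinity>" using False by (metis enat_ord_simps(5))+
    let ?Q = "{q. b q \<noteq> 0}"
    have Q: "finite ?Q" by (rule finite_support_of_suminf(1)[OF False])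
    let ?a = "\<lambda>q. the_enat (a q)" and ?c = "\<lambda>q. the_enat (c q)"
    have a: "a q = enat (?a q)" for q
      using finite_support_of_suminf(2)[OF ac(1), of q] by (cases "a q") auto
    have c: "c q = enat (?c q)" for q
      using finite_support_of_suminf(2)[OF ac(2), of q] by (cases "c q") auto
    have bq: "b q = enat (?a q + ?c q)" for q
      unfolding b plus_enat_simps(1)[symmetric] by (simp only: a[symmetric] c[symmetric])
    have chi_a: "euler_char a = (\<Sum>q\<in>?Q. (- 1) ^ q * int (?a q))"
      by (rule euler_char_eq_sum[OF ac(1) Q]) (auto simp: b)
    have chi_c: "euler_char c = (\<Sum>q\<in>?Q. (- 1) ^ q * int (?c q))"
      by (rule euler_char_eq_sum[OF ac(2) Q]) (auto simp: b)
    have "euler_char b = (\<Sum>q\<in>?Q. (- 1) ^ q * int (the_enat (b q)))"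
      by (rule euler_char_eq_sum[OF False Q]) simp
    also have "\<dots> = (\<Sum>q\<in>?Q. (- 1) ^ q * int (?a q) + (- 1) ^ q * int (?c q))"
      by (intro sum.cong refl) (subst bq, simp add: distrib_left)
    also have "\<dots> = euler_char a + euler_char c"
      by (simp only: sum.distrib chi_a chi_c)
    finally have triangle: "\<bar>euler_char b\<bar> \<le> \<bar>euler_char a\<bar> + \<bar>euler_char c\<bar>" by simp
    have "\<bar>\<Sum>q\<in>?Q. (- 1) ^ q * int (f q)\<bar> \<le> int (\<Sum>q\<in>?Q. f q)" for f
      using sum_abs[of "\<lambda>q. (- 1) ^ q * int (f q)" ?Q] by (simp add: abs_mult power_abs)
    then have "\<bar>euler_char a\<bar> + \<bar>euler_char c\<bar> \<le> int (\<Sum>q\<in>?Q. ?a q + ?c q)"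
      unfolding chi_a chi_c sum.distrib of_nat_add by (intro add_mono)
    then have "enat (nat (\<bar>euler_char a\<bar> + \<bar>euler_char c\<bar>)) \<le> enat (\<Sum>q\<in>?Q. ?a q + ?c q)"
      by (simp only: enat_ord_simps(1) nat_le_iff)
    also have "\<dots> = (\<Sum>q\<in>?Q. b q)"
      unfolding bq enat_sum ..
    also have "\<dots> \<le> (\<Sum>q. b q)"
      using Q by (intro sum_le_suminf) auto
    finally show ?thesis using triangle by blast
  qed
  then show "enat (nat (\<bar>euler_char a\<bar> + \<bar>euler_char c\<bar>)) \<le> (\<Sum>q. b q)"
    and "\<bar>euler_char b\<bar> \<le> \<bar>euler_char a\<bar> + \<bar>euler_char c\<bar>" by blast+
qed

theorem corollary16:
  fixes l1 l2 l3 :: nat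
    and M Mt :: "rat^4^4 \<Rightarrow> rat^'n^'n"
  assumes nontrivial: "(l1, l2, l3) \<noteq> (0, 0, 0)"
    and M: "irreducible_hw_rep SL4_Q (dominant_weight l1 l2 l3) M"
    and Mt: "irreducible_hw_rep GL4_Q (dominant_weight l1 l2 l3) Mt"
    and extends: "\<forall>A\<in>SL4_Q. Mt A = M A"
  shows "(\<Sum>q. betti_SL M q) \<ge> enat (nat (\<bar>chi_GL 0 Mt\<bar> + \<bar>chi_GL 1 Mt\<bar>)) \<and>
         \<bar>chi_GL 0 Mt\<bar> + \<bar>chi_GL 1 Mt\<bar> \<ge> \<bar>chi_SL M\<bar>"
proof -
  have "polynomial_rep GL4_Q Mt"
    using Mt by (simp add: irreducible_hw_rep_def)
  note decomposition = betti_SL_decomposition[OF this extends]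
  show ?thesis
    unfolding chi_GL_def chi_SL_def
    using euler_char_add[of "betti_SL M", OF decomposition] by blast
qed

end
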